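(* Let $\beta>1$ be a real number. (i) If $\log\beta>\pi^2/(6\log2)$, then for $\lambda$-almost all $x\in[0,1)$ there exists a positive integer $N_1$ (depending on $x$) such that for all $n\ge N_1$, \[ \left|x-\frac{p_n(x)}{q_n(x)}\right|>x-x_n. \] (ii) If $\log\beta<\pi^2/(6\log2)$, then for $\lambda$-almost all $x\in[0,1)$ there exists a positive integer $N_2$ (depending on $x$) such that for all $n\ge N_2$, \[ \left|x-\frac{p_n(x)}{q_n(x)}\right|<x-x_n. \]
   Context: $\lambda$ is Lebesgue measure on $[0,1)$, $\log$ is the natural logarithm, and $[y]$ denotes the greatest integer not exceeding $y$. $\beta$-expansion: for real $\beta>1$ let $T_\beta:[0,1)\to[0,1)$, $T_\beta(x)=\beta x-[\beta x]$. The digits of $x\in[0,1)$ are $\varepsilon_1(x)=[\beta x]$ and $\varepsilon_{n+1}(x)=\varepsilon_1(T_\beta^n x)$ for $n\ge1$. The $n$-th convergent of the $\beta$-expansion of $x$ is $x_n=\sum_{i=1}^n\varepsilon_i(x)\beta^{-i}$. Continued fractions: let $T(0)=0$ and $T(x)=1/x-[1/x]$ for $x\in(0,1)$ (Gauss transformation). The partial quotients of an irrational $x\in[0,1)$ are $a_1(x)=[1/x]$, $a_{n+1}(x)=a_1(T^nx)$. The $n$-th convergent of its continued fraction is \[ \frac{p_n(x)}{q_n(x)}=[a_1(x),\dots,a_n(x)]=\cfrac{1}{a_1(x)+\cfrac{1}{a_2(x)+\cdots+\cfrac{1}{a_n(x)}}}, \] with $p_n(x),q_n(x)$ relatively prime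 positive integers. *)

theory Defs
  imports "HOL-Analysis.Analysis"
begin

section \<open>Beta-expansions\<close>

definition beta_map :: "real \<Rightarrow> real \<Rightarrow> real" where
  "beta_map \<beta> x = \<beta> * x - of_int \<lfloor>\<beta> * x\<rfloor>"

text \<open>
  Digits are indexed from \<open>n = 1\<close>, so the digit with index \<open>n + 1\<close> is the first digit of the
  \<open>n\<close>-th iterate; the value at \<open>n = 0\<close> (which truncated subtraction identifies with the one
  at \<open>n = 1\<close>) is never used. The same convention applies to partial quotients below.
\<close>

definition beta_digit :: "real \<Rightarrow> nat \<Rightarrow> real \<Rightarrow> int" where
  "beta_digit \<beta> n x = \<lfloor>\<beta> * (beta_map \<beta> ^^ (n - 1)) x\<rfloor>"

definition beta_convergent :: "real \<Rightarrow> nat \<Rightarrow> real \<Rightarrow> real" where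
  "beta_convergent \<beta> n x = (\<Sum>i = 1..n. of_int (beta_digit \<beta> i x) / \<beta> ^ i)"

section \<open>Continued fractions\<close>

definition gauss_map :: "real \<Rightarrow> real" where
  "gauss_map x = (if x = 0 then 0 else 1 / x - of_int \<lfloor>1 / x\<rfloor>)"

definition partial_quotient :: "nat \<Rightarrow> real \<Rightarrow> int" where
  "partial_quotient n x = \<lfloor>1 / (gauss_map ^^ (n - 1)) x\<rfloor>"

fun cfrac_value :: "int list \<Rightarrow> rat" where
  "cfrac_value [] = 0"
| "cfrac_value (a # as) = 1 / (of_int a + cfrac_value as)"

definition cfrac_convergent :: "nat \<Rightarrow> real \<Rightarrow> rat" where
  "cfrac_convergent n x = cfrac_value (map (\<lambda>i. partial_quotient i x) [1..<Suc n])"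

text \<open>
  \<^const>\<open>quotient_of\<close> returns the representation in lowest terms with positive denominator.
  At rational \<open>x\<close> the values below are meaningless; these \<open>x\<close> form a null set.
\<close>

definition cfrac_num :: "nat \<Rightarrow> real \<Rightarrow> int" where
  "cfrac_num n x = fst (quotient_of (cfrac_convergent n x))"

definition cfrac_denom :: "nat \<Rightarrow> real \<Rightarrow> int" where
  "cfrac_denom n x = snd (quotient_of (cfrac_convergent n x))"

lemma cfrac_num_div_denom:
  "real_of_int (cfrac_num n x) / real_of_int (cfrac_denom n x) = of_rat (cfrac_convergent n x)"
proof -
  have "cfrac_convergent n x = of_int (cfrac_num n x) / of_int (cfrac_denom n x)"
    unfolding cfrac_num_def cfrac_denom_def by (rule quotient_of_div) simp
  then show ?thesis by (simp add: of_rat_divide)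
qed

lemma coprime_cfrac_num_denom: "coprime (cfrac_num n x) (cfrac_denom n x)"
  unfolding cfrac_num_def cfrac_denom_def by (rule quotient_of_coprime) simp

lemma cfrac_denom_pos: "cfrac_denom n x > 0"
  unfolding cfrac_denom_def by (rule quotient_of_denom_pos')

lemma cfrac_value_nonneg: "(\<And>a. a \<in> set as \<Longrightarrow> a \<ge> 1) \<Longrightarrow> cfrac_value as \<ge> 0"
  by (induction as) force+

lemma cfrac_value_pos:
  assumes "\<And>a. a \<in> set as \<Longrightarrow> a \<ge> 1" "as \<noteq> []"
  shows "cfrac_value as > 0"
proof (cases as)
  case (Cons a bs)
  have "cfrac_value bs \<ge> 0" using assms Cons by (intro cfrac_value_nonneg) auto
  moreover have "rat_of_int a > 0" using assms Cons by force
  ultimately show ?thesis using Cons by simp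
qed (use assms in simp)

lemma gauss_map_iterate_irrational:
  assumes "x \<in> {0..<1}" "x \<notin> \<rat>"
  shows "(gauss_map ^^ n) x \<in> {0<..<1} - \<rat>"
proof (induction n)
  case 0
  have "x \<noteq> 0" using assms(2) Rats_0 by blast
  then show ?case using assms by auto
next
  case (Suc n)
  let ?y = "(gauss_map ^^ n) x"
  have y: "?y \<noteq> 0" "?y \<notin> \<rat>" using Suc by auto
  have "1 / ?y \<notin> \<rat>"
    using y(2) Rats_inverse[of "1 / ?y"] by auto
  then have *: "frac (1 / ?y) \<notin> \<rat>"
    unfolding frac_def by (metis Rats_add Rats_of_int diff_add_cancel)
  then have "frac (1 / ?y) \<noteq> 0" using Rats_0 by metis
  then have "frac (1 / ?y) > 0" using frac_ge_0[of "1 / ?y"] by linarith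
  moreover have "(gauss_map ^^ Suc n) x = frac (1 / ?y)"
    using y(1) by (simp add: gauss_map_def[of ?y] frac_def)
  ultimately show ?case using * frac_lt_1[of "1 / ?y"] by simp
qed

lemma cfrac_num_pos:
  assumes "x \<in> {0..<1}" "x \<notin> \<rat>" "n \<ge> 1"
  shows "cfrac_num n x > 0"
proof -
  have pq: "partial_quotient i x \<ge> 1" for i
    using gauss_map_iterate_irrational[OF assms(1,2), of "i - 1"]
    by (simp add: partial_quotient_def le_floor_iff)
  have "cfrac_convergent n x > 0"
    unfolding cfrac_convergent_def using pq assms(3) by (intro cfrac_value_pos) auto
  then have "real_of_rat (cfrac_convergent n x) > 0" by simp
  then have "real_of_int (cfrac_num n x) / real_of_int (cfrac_denom n x) > 0"
    by (simp only: cfrac_num_div_denom)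
  then show ?thesis using cfrac_denom_pos[of n x] by (simp add: zero_less_divide_iff)
qed

end

theory Submission
  imports Defs "HOL-Probability.Probability" "HOL-Real_Asymp.Real_Asymp"
begin

text \<open>
  The error of the \<open>n\<close>-th convergent of the continued fraction of \<open>x\<close> is the product over \<open>k < n\<close> of
  \<open>T\<^sup>k x\<close> times the \<open>(n - k)\<close>-th convergent of \<open>T\<^sup>k x\<close>, times \<open>T\<^sup>n x\<close>. Convergents approximate exponentially
  well, so the logarithm of the error is twice the Birkhoff sum of \<open>ln\<close> along the Gauss map \<open>T\<close>, up to a bounded
  quantity and the term \<open>ln (T\<^sup>n x)\<close>. The Gauss measure is invariant and ergodic, and \<open>ln\<close> has mean \<open>- pi\<^sup>2 / (12 ln 2)\<close>;
  by Birkhoff's theorem the error decays almost surely like \<open>exp (- n pi\<^sup>2 / (6 ln 2))\<close>.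
  The error of the beta-expansion is \<open>T\<^sub>\<beta>\<^sup>n x / \<beta>\<^sup>n\<close>, where \<open>T\<^sub>\<beta>\<^sup>n x < 1\<close> and, by Borel--Cantelli and the bound
  \<open>\<lambda>(T\<^sub>\<beta>\<^sup>n x < \<delta>) = O(\<delta>)\<close>, almost surely \<open>T\<^sub>\<beta>\<^sup>n x\<close> is eventually larger than \<open>exp (- \<eta> n)\<close> for every \<open>\<eta> > 0\<close>.
\<close>

section \<open>Birkhoff's ergodic theorem\<close>

definition birkhoff_sum :: "('a \<Rightarrow> 'a) \<Rightarrow> ('a \<Rightarrow> real) \<Rightarrow> nat \<Rightarrow> 'a \<Rightarrow> real" where
  "birkhoff_sum T f n x = (\<Sum>k<n. f ((T ^^ k) x))"

lemma birkhoff_sum_Suc: "birkhoff_sum T f (Suc n) x = f x + birkhoff_sum T f n (T x)"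
  unfolding birkhoff_sum_def by (simp add: sum.lessThan_Suc_shift funpow_swap1 del: sum.lessThan_Suc)

text \<open>\<open>birkhoff_max T g N\<close> is the maximum of the Birkhoff sums of length at most \<open>N\<close>.\<close>

primrec birkhoff_max :: "('a \<Rightarrow> 'a) \<Rightarrow> ('a \<Rightarrow> real) \<Rightarrow> nat \<Rightarrow> 'a \<Rightarrow> real" where
  "birkhoff_max T g 0 x = 0"
| "birkhoff_max T g (Suc N) x = max 0 (g x + birkhoff_max T g N (T x))"

lemma birkhoff_max_nonneg: "birkhoff_max T g N x \<ge> 0"
  by (cases N) auto

lemma birkhoff_max_mono: "birkhoff_max T g N x \<le> birkhoff_max T g (Suc N) x"
proof (induction N arbitrary: x)
  case (Suc N)
  have "max 0 (g x + birkhoff_max T g N (T x)) \<le> max 0 (g x + birkhoff_max T g (Suc N) (T x))"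
    using Suc[of "T x"] by linarith
  then show ?case by simp
qed auto

lemma birkhoff_sum_le_max: "birkhoff_sum T g n x \<le> birkhoff_max T g n x"
proof (induction n arbitrary: x)
  case (Suc n)
  have "g x + birkhoff_sum T g n (T x) \<le> max 0 (g x + birkhoff_max T g n (T x))"
    using Suc[of "T x"] by linarith
  then show ?case by (simp add: birkhoff_sum_Suc)
qed (simp add: birkhoff_sum_def)

section \<open>The maximal ergodic theorem\<close>

locale measure_preserving_map = prob_space +
  fixes T :: "'a \<Rightarrow> 'a"
  assumes T_meas [measurable]: "T \<in> M \<rightarrow>\<^sub>M M"
    and T_inv: "distr M M T = M"
begin

lemma integrable_comp:
  fixes f :: "'a \<Rightarrow> real"
  assumes "integrable M f" shows "integrable M (\<lambda>x. f (T x))"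
  using integrable_distr[OF T_meas, of f] assms T_inv by simp

lemma integral_comp:
  fixes f :: "'a \<Rightarrow> real"
  assumes [measurable]: "f \<in> borel_measurable M" shows "(\<integral>x. f (T x) \<partial>M) = integral\<^sup>L M f"
  using integral_distr[OF T_meas, of f] T_inv by simp

lemma integrable_birkhoff_max:
  assumes "integrable M g" shows "integrable M (birkhoff_max T g N)"
proof (induction N)
  case (Suc N)
  show ?case using assms integrable_comp[OF Suc] by simp
qed simp

text \<open>Garsia's argument. Where \<open>birkhoff_max T g (Suc N)\<close> is positive it equals
  \<open>g x + birkhoff_max T g N (T x)\<close>; elsewhere it is 0, and the value at
  \<open>T x\<close> is nonnegative. So its excess over \<open>birkhoff_max T g N (T x)\<close> is
  at most \<open>h N\<close>, while invariance and monotonicity in \<open>N\<close> make the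
  integral of that excess nonnegative.\<close>

lemma maximal_ergodic:
  assumes g: "integrable M g" and pos: "AE x in M. \<exists>N. birkhoff_max T g N x > 0"
  shows "integral\<^sup>L M g \<ge> 0"
proof -
  let ?m = "birkhoff_max T g"
  have m_int: "integrable M (?m N)" for N by (rule integrable_birkhoff_max[OF g])
  have [measurable]: "g \<in> borel_measurable M" "\<And>N. ?m N \<in> borel_measurable M"
    using g m_int by auto
  define h where "h N x = (if ?m (Suc N) x > 0 then g x else 0)" for N x
  have nonneg: "integral\<^sup>L M (h N) \<ge> 0" for N
  proof -
    have "0 \<le> (\<integral>x. ?m (Suc N) x \<partial>M) - (\<integral>x. ?m N x \<partial>M)"
      using integral_mono[OF m_int m_int birkhoff_max_mono] by (simp only: diff_ge_0_iff_ge)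
    also have "\<dots> = (\<integral>x. ?m (Suc N) x \<partial>M) - (\<integral>x. ?m N (T x) \<partial>M)"
      using integral_comp by simp
    also have "\<dots> = (\<integral>x. ?m (Suc N) x - ?m N (T x) \<partial>M)"
      by (rule Bochner_Integration.integral_diff[symmetric]) (intro m_int integrable_comp)+
    also have "\<dots> \<le> integral\<^sup>L M (h N)"
    proof (rule integral_mono)
      show "integrable M (\<lambda>x. ?m (Suc N) x - ?m N (T x))"
        by (intro Bochner_Integration.integrable_diff m_int integrable_comp)
      show "integrable M (h N)" unfolding h_def
        by (rule Bochner_Integration.integrable_bound[OF g]) auto
      show "?m (Suc N) x - ?m N (T x) \<le> h N x" for x
        using birkhoff_max_nonneg[of T g N "T x"] by (auto simp: h_def)
    qed
    finally show ?thesis .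
  qed
  \<comment> \<open>Once positive, the maximum stays positive as \<open>N\<close> grows, so
    \<open>h N x\<close> is eventually equal to \<open>g x\<close> for almost every
    \<open>x\<close>.\<close>
  have "(\<lambda>N. integral\<^sup>L M (h N)) \<longlonglongrightarrow> integral\<^sup>L M g"
  proof (rule integral_dominated_convergence[where w="\<lambda>x. norm (g x)"])
    show "AE x in M. (\<lambda>N. h N x) \<longlonglongrightarrow> g x" using pos
    proof eventually_elim
      case (elim x)
      then obtain N where N: "?m N x > 0" by auto
      have "?m (Suc n) x > 0" if "n \<ge> N" for n
        using N lift_Suc_mono_le[of "\<lambda>n. ?m n x" N "Suc n"] birkhoff_max_mono[of T g _ x] that
        by (simp del: birkhoff_max.simps)
      then have "eventually (\<lambda>n. h n x = g x) sequentially"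
        unfolding eventually_sequentially h_def by (auto simp del: birkhoff_max.simps)
      then show ?case by (rule tendsto_eventually)
    qed
  qed (use g in \<open>auto simp: h_def[abs_def]\<close>)
  then show ?thesis using nonneg by (intro LIMSEQ_le_const[OF _ ]) auto
qed

end

section \<open>Pointwise convergence under ergodicity\<close>

locale ergodic_map = measure_preserving_map +
  assumes ergodic: "\<And>A. A \<in> sets M \<Longrightarrow> T -` A \<inter> space M = A \<Longrightarrow> prob A = 0 \<or> prob A = 1"
begin

lemma birkhoff_sum_measurable [measurable]:
  assumes [measurable]: "f \<in> borel_measurable M"
  shows "birkhoff_sum T f n \<in> borel_measurable M"
proof -
  have [measurable]: "(T ^^ k) \<in> M \<rightarrow>\<^sub>M M" for k by (rule measurable_compose_n[OF T_meas])
  show ?thesis unfolding birkhoff_sum_def by measurable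
qed

text \<open>The sums at \<open>x\<close> and at \<open>T x\<close> differ by one index and the
  constant \<open>g x\<close>, so the set \<open>B\<close> of unbounded sums is exactly invariant
  and has probability 0 or 1. Probability 1 would make some \<open>birkhoff_max\<close> positive
  almost everywhere, and the maximal ergodic theorem would contradict the negative mean.\<close>

lemma birkhoff_sum_bdd_above:
  assumes g: "integrable M g" and neg: "integral\<^sup>L M g < 0"
  shows "AE x in M. \<exists>K. \<forall>n. birkhoff_sum T g n x \<le> K"
proof -
  have [measurable]: "g \<in> borel_measurable M" using g by auto
  \<comment> \<open>Natural bounds keep \<open>B\<close> a countable combination of measurable sets;
    \<open>unbdd\<close> passes to real bounds, which can be shifted by \<open>g x\<close>.\<close>
  define B where "B = {x\<in>space M. \<forall>K::nat. \<exists>n. birkhoff_sum T g n x > real K}"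
  have B [measurable]: "B \<in> sets M" unfolding B_def by measurable
  have unbdd: "(\<forall>K::nat. \<exists>n. birkhoff_sum T g n x > real K) \<longleftrightarrow> (\<forall>K. \<exists>n. birkhoff_sum T g n x > K)" for x
  proof (intro iffI allI)
    fix K :: real assume *: "\<forall>K::nat. \<exists>n. birkhoff_sum T g n x > real K"
    obtain k :: nat where "K < real k" using reals_Archimedean2 by blast
    moreover obtain n where "birkhoff_sum T g n x > real k" using * by blast
    ultimately have "birkhoff_sum T g n x > K" by linarith
    then show "\<exists>n. birkhoff_sum T g n x > K" ..
  qed blast
  have "T -` B \<inter> space M = B"
  proof -
    have "(\<forall>K. \<exists>n. birkhoff_sum T g n (T x) > K) \<longleftrightarrow> (\<forall>K. \<exists>n. birkhoff_sum T g n x > K)" for x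
    proof
      assume L: "\<forall>K. \<exists>n. birkhoff_sum T g n (T x) > K"
      show "\<forall>K. \<exists>n. birkhoff_sum T g n x > K"
      proof
        fix K
        obtain n where "birkhoff_sum T g n (T x) > K - g x" using L by auto
        then have "birkhoff_sum T g (Suc n) x > K" by (simp add: birkhoff_sum_Suc)
        then show "\<exists>n. birkhoff_sum T g n x > K" ..
      qed
    next
      assume R: "\<forall>K. \<exists>n. birkhoff_sum T g n x > K"
      show "\<forall>K. \<exists>n. birkhoff_sum T g n (T x) > K"
      proof
        fix K
        \<comment> \<open>The maximum with 0 excludes the empty sum, so a first term can be split
          off.\<close>
        obtain n where n: "birkhoff_sum T g n x > max 0 (K + g x)" using R by blast
        then obtain n' where "n = Suc n'" by (cases n) (auto simp: birkhoff_sum_def)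
        then show "\<exists>n. birkhoff_sum T g n (T x) > K" using n by (auto simp: birkhoff_sum_Suc intro!: exI[of _ n'])
      qed
    qed
    then show ?thesis using measurable_space[OF T_meas] by (auto simp: B_def unbdd)
  qed
  then have "prob B = 0 \<or> prob B = 1" by (rule ergodic[OF B])
  moreover have "prob B \<noteq> 1"
  proof
    assume "prob B = 1"
    then have "AE x in M. x \<in> B" by (simp add: prob_eq_1)
    then have "AE x in M. \<exists>N. birkhoff_max T g N x > 0"
    proof eventually_elim
      case (elim x)
      then obtain n where "birkhoff_sum T g n x > real 0" unfolding B_def by blast
      then show ?case using birkhoff_sum_le_max[of T g n x] by (auto intro!: exI[of _ n])
    qed
    then show False using maximal_ergodic[OF g] neg by simp
  qed
  ultimately have "AE x in M. x \<notin> B" by (simp add: prob_eq_0)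
  then show ?thesis using AE_space
  proof eventually_elim
    case (elim x)
    then obtain K :: nat where "\<And>n. \<not> birkhoff_sum T g n x > real K" unfolding B_def by blast
    then show ?case by (intro exI[of _ "real K"]) (simp add: not_less)
  qed
qed

text \<open>Subtracting the mean plus \<open>e/2\<close> leaves a function of mean
  \<open>- e/2\<close>, whose sums are bounded by some \<open>K\<close>; after division by
  \<open>n\<close>, the term \<open>K / n\<close> falls below the remaining
  \<open>e/2\<close>.\<close>

lemma birkhoff_upper:
  fixes f :: "'a \<Rightarrow> real" and e :: real
  assumes f: "integrable M f" and e: "e > 0"
  shows "AE x in M. eventually (\<lambda>n. birkhoff_sum T f n x / real n < integral\<^sup>L M f + e) sequentially"
proof -
  let ?c = "integral\<^sup>L M f + e/2"
  have "AE x in M. \<exists>K. \<forall>n. birkhoff_sum T (\<lambda>x. f x - ?c) n x \<le> K"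
  proof (rule birkhoff_sum_bdd_above)
    show "integrable M (\<lambda>x. f x - ?c)" using f by simp
    have "(\<integral>x. f x - ?c \<partial>M) = integral\<^sup>L M f - ?c"
      using f by (subst Bochner_Integration.integral_diff) (simp_all add: prob_space)
    then show "(\<integral>x. f x - ?c \<partial>M) < 0" using e by simp
  qed
  then show ?thesis
  proof eventually_elim
    case (elim x)
    then obtain K where "\<And>n. birkhoff_sum T (\<lambda>x. f x - ?c) n x \<le> K" by blast
    moreover have "birkhoff_sum T (\<lambda>x. f x - ?c) n x = birkhoff_sum T f n x - n * ?c" for n
      by (simp only: birkhoff_sum_def sum_subtractf sum_constant card_lessThan)
    ultimately have K: "birkhoff_sum T f n x \<le> K + n * ?c" for n by (simp only: diff_le_eq)
    have "(\<lambda>n. K / real n) \<longlonglongrightarrow> 0" by (rule lim_const_over_n)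
    then have "eventually (\<lambda>n. K / real n < e / 2) sequentially"
      using e by (intro order_tendstoD(2)[of _ 0]) auto
    then show ?case using eventually_gt_at_top[of 0]
    proof eventually_elim
      case (elim n)
      have "birkhoff_sum T f n x / n \<le> (K + n * ?c) / n"
        using K[of n] by (intro divide_right_mono) auto
      also have "\<dots> = K / n + ?c" using elim by (simp add: field_simps)
      finally show ?case using elim by linarith
    qed
  qed
qed

text \<open>The upper bound for \<open>- f\<close> is a lower bound for \<open>f\<close>. The
  tolerances \<open>1 / real (Suc j)\<close> leave only countably many exceptional null
  sets.\<close>

theorem birkhoff_ergodic:
  assumes f: "integrable M f"
  shows "AE x in M. (\<lambda>n. birkhoff_sum T f n x / n) \<longlonglongrightarrow> integral\<^sup>L M f"
proof -
  let ?e = "\<lambda>j. 1 / real (Suc j)"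
  have "AE x in M. \<forall>j. eventually (\<lambda>n. birkhoff_sum T f n x / n < integral\<^sup>L M f + ?e j) sequentially"
    using birkhoff_upper[OF f] by (subst AE_all_countable) auto
  moreover have "AE x in M. \<forall>j. eventually (\<lambda>n. birkhoff_sum T (\<lambda>x. - f x) n x / n < integral\<^sup>L M (\<lambda>x. - f x) + ?e j) sequentially"
    using birkhoff_upper[of "\<lambda>x. - f x"] f by (subst AE_all_countable) auto
  ultimately show ?thesis
  proof eventually_elim
    case (elim x)
    have neg: "birkhoff_sum T (\<lambda>x. - f x) n x = - birkhoff_sum T f n x" for n
      by (simp add: birkhoff_sum_def sum_negf)
    show ?case
    proof (rule order_tendstoI)
      fix a assume "a < integral\<^sup>L M f"
      then obtain j where "?e j < integral\<^sup>L M f - a" using nat_approx_posE[of "integral\<^sup>L M f - a"] by auto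
      with elim(2) show "eventually (\<lambda>n. a < birkhoff_sum T f n x / n) sequentially"
        by (auto elim!: allE[of _ j] eventually_mono simp: neg)
    next
      fix a assume "a > integral\<^sup>L M f"
      then obtain j where "?e j < a - integral\<^sup>L M f" using nat_approx_posE[of "a - integral\<^sup>L M f"] by auto
      with elim(1) show "eventually (\<lambda>n. birkhoff_sum T f n x / n < a) sequentially"
        by (auto elim!: allE[of _ j] eventually_mono)
    qed
  qed
qed

end

section \<open>The Gauss map\<close>

text \<open>Carried by the unit interval but defined on all Borel sets of the line, so that
  preimages under the Gauss map need no intersection with the space.\<close>

definition unit_density :: "(real \<Rightarrow> real) \<Rightarrow> real measure" where
  "unit_density f = density lborel (\<lambda>x. ennreal (indicator {0<..<1} x * f x))"

lemma sets_unit_density [simp, measurable_cong]: "sets (unit_density f) = sets borel"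
  and space_unit_density [simp]: "space (unit_density f) = UNIV"
  by (simp_all add: unit_density_def)

lemma AE_unit_density:
  assumes "f \<in> borel_measurable borel" "\<And>x. x \<in> {0<..<1} \<Longrightarrow> f x > 0"
  shows "(AE x in unit_density f. P x) \<longleftrightarrow> (AE x in lborel. x \<in> {0<..<1} \<longrightarrow> P x)"
  unfolding unit_density_def using assms
  by (subst AE_density) (auto simp: indicator_def intro!: AE_cong)

lemma emeasure_unit_density_Int:
  assumes [measurable]: "f \<in> borel_measurable borel" "S \<in> sets borel"
  shows "emeasure (unit_density f) S = emeasure (unit_density f) (S \<inter> {0<..<1})"
  unfolding unit_density_def
  by (subst (1 2) emeasure_density) (auto intro!: nn_integral_cong simp: indicator_def)

text \<open>The endpoints are Lebesgue null, so \<open>S\<close> has to agree with the interval only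
  up to them. This covers sets given by strict or weak inequalities alike.\<close>

lemma emeasure_unit_density_interval:
  assumes [measurable]: "f \<in> borel_measurable borel" "S \<in> sets borel"
    and F: "\<And>x. 0 \<le> x \<Longrightarrow> x \<le> 1 \<Longrightarrow> (F has_real_derivative f x) (at x)"
    and f: "\<And>x. 0 \<le> x \<Longrightarrow> x \<le> 1 \<Longrightarrow> f x \<ge> 0"
    and uv: "0 \<le> u" "u \<le> v" "v \<le> 1" and S: "{u<..<v} \<subseteq> S \<inter> {0<..<1}" "S \<inter> {0<..<1} \<subseteq> {u..v}"
  shows "emeasure (unit_density f) S = ennreal (F v - F u)"
proof -
  have "emeasure (unit_density f) S = (\<integral>\<^sup>+x. ennreal (indicator {0<..<1} x * f x) * indicator S x \<partial>lborel)"
    unfolding unit_density_def by (rule emeasure_density) auto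
  also have "\<dots> = (\<integral>\<^sup>+x. ennreal (f x) * indicator {u..v} x \<partial>lborel)"
  proof (rule nn_integral_cong_AE)
    have "AE x in lborel. x \<noteq> u \<and> x \<noteq> v"
      using AE_lborel_singleton[of u] AE_lborel_singleton[of v] by eventually_elim auto
    then show "AE x in lborel. ennreal (indicator {0<..<1} x * f x) * indicator S x = ennreal (f x) * indicator {u..v} x"
    proof eventually_elim
      case (elim x)
      have "x \<in> S \<inter> {0<..<1} \<longleftrightarrow> x \<in> {u..v}"
        using S elim by (auto simp: less_le)
      then show ?case by (auto simp: indicator_def)
    qed
  qed
  also have "\<dots> = ennreal (F v - F u)"
    by (rule nn_integral_FTC_Icc) (use F f uv in \<open>auto intro: DERIV_subset\<close>)
  finally show ?thesis .
qed

lemma unit_density_mono: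
  assumes [measurable]: "f \<in> borel_measurable borel" "g \<in> borel_measurable borel" "B \<in> sets borel"
    and "\<And>x. x \<in> {0<..<1} \<Longrightarrow> f x \<le> g x"
  shows "emeasure (unit_density f) B \<le> emeasure (unit_density g) B"
  unfolding unit_density_def using assms(4)
  by (subst (1 2) emeasure_density) (auto intro!: nn_integral_mono ennreal_leI mult_right_mono simp: indicator_def)

definition gauss_measure :: "real measure" where
  "gauss_measure = unit_density (\<lambda>x. 1 / (ln 2 * (1 + x)))"

text \<open>The law of \<open>T\<^sup>n x\<close>, for Lebesgue-distributed \<open>x\<close> in a cylinder of order \<open>n\<close>, is
  \<open>cylinder_law c\<close> with \<open>c = q\<^sub>n\<^sub>-\<^sub>1 / q\<^sub>n\<close>.\<close>

definition cylinder_law :: "real \<Rightarrow> real measure" where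
  "cylinder_law c = unit_density (\<lambda>x. (1 + c) / (1 + c * x)\<^sup>2)"

lemma sets_gauss_measure [simp, measurable_cong]: "sets gauss_measure = sets borel"
  and space_gauss_measure [simp]: "space gauss_measure = UNIV"
  and sets_cylinder_law [simp, measurable_cong]: "sets (cylinder_law c) = sets borel"
  and space_cylinder_law [simp]: "space (cylinder_law c) = UNIV"
  by (simp_all add: gauss_measure_def cylinder_law_def)

lemma gauss_map_eq_frac: "gauss_map x = frac (1 / x)"
  by (simp add: gauss_map_def frac_def)

lemma gauss_map_measurable [measurable]: "gauss_map \<in> borel_measurable borel"
  unfolding gauss_map_def[abs_def] by measurable

lemma emeasure_gauss_interval:
  assumes "S \<in> sets borel" "0 \<le> u" "u \<le> v" "v \<le> 1" 
    "{u<..<v} \<subseteq> S \<inter> {0<..<1}" "S \<inter> {0<..<1} \<subseteq> {u..v}"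
  shows "emeasure gauss_measure S = ennreal ((ln (1 + v) - ln (1 + u)) / ln 2)"
proof -
  have "emeasure gauss_measure S = ennreal (ln (1 + v) / ln 2 - ln (1 + u) / ln 2)"
    unfolding gauss_measure_def
    by (rule emeasure_unit_density_interval) (use assms in \<open>auto intro!: derivative_eq_intros\<close>)
  then show ?thesis by (simp add: diff_divide_distrib)
qed

lemma emeasure_cylinder_law_interval:
  assumes c: "0 \<le> c" and S: "S \<in> sets borel" "0 \<le> u" "u \<le> v" "v \<le> 1" 
    "{u<..<v} \<subseteq> S \<inter> {0<..<1}" "S \<inter> {0<..<1} \<subseteq> {u..v}"
  shows "emeasure (cylinder_law c) S = ennreal ((1 + c) * (v - u) / ((1 + c * u) * (1 + c * v)))"
proof -
  have p: "1 + c * x > 0" if "x \<ge> 0" for x using that c by (simp add: add_pos_nonneg)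
  have "emeasure (cylinder_law c) S = ennreal ((1 + c) * v / (1 + c * v) - (1 + c) * u / (1 + c * u))"
    unfolding cylinder_law_def
  proof (rule emeasure_unit_density_interval[where F="\<lambda>v. (1 + c) * v / (1 + c * v)"])
    show "((\<lambda>v. (1 + c) * v / (1 + c * v)) has_real_derivative (1 + c) / (1 + c * x)\<^sup>2) (at x)"
      if "0 \<le> x" for x
      using p[OF that] by (auto intro!: derivative_eq_intros simp: power2_eq_square algebra_simps)
  qed (use S c in auto)
  also have "(1 + c) * v / (1 + c * v) - (1 + c) * u / (1 + c * u) = (1 + c) * (v - u) / ((1 + c * u) * (1 + c * v))"
  proof -
    have "v / (1 + c * v) - u / (1 + c * u) = (v - u) / ((1 + c * u) * (1 + c * v))"
      using p[of u] p[of v] S(2,3) by (simp add: divide_simps) (simp add: algebra_simps)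
    then show ?thesis by (metis right_diff_distrib times_divide_eq_right)
  qed
  finally show ?thesis .
qed

lemma prob_space_gauss_measure: "prob_space gauss_measure"
proof
  show "emeasure gauss_measure (space gauss_measure) = 1"
    by (subst emeasure_gauss_interval[where u=0 and v=1]) auto
qed

lemma prob_space_cylinder_law: "0 \<le> c \<Longrightarrow> prob_space (cylinder_law c)"
proof
  show "emeasure (cylinder_law c) (space (cylinder_law c)) = 1" if "0 \<le> c"
    using that by (subst emeasure_cylinder_law_interval[where u=0 and v=1]) auto
qed

section \<open>Invariance of the Gauss measure\<close>

lemma gauss_map_branch:
  assumes "0 < x" "x < 1" "0 \<le> t" "t < 1" "a \<ge> 1"
  shows "\<lfloor>1 / x\<rfloor> = a \<and> gauss_map x > t \<longleftrightarrow> 1 / (of_int a + 1) < x \<and> x < 1 / (of_int a + t)"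
proof -
  have "\<lfloor>1 / x\<rfloor> = a \<and> gauss_map x > t \<longleftrightarrow> \<lfloor>1 / x\<rfloor> = a \<and> of_int a + t < 1 / x"
    using assms by (auto simp: gauss_map_def)
  also have "\<dots> \<longleftrightarrow> of_int a + t < 1 / x \<and> 1 / x < of_int a + 1"
    using assms by (auto simp: floor_eq_iff)
  also have "\<dots> \<longleftrightarrow> 1 / (of_int a + 1) < x \<and> x < 1 / (of_int a + t)"
    using assms by (auto simp: field_simps add_pos_nonneg)
  finally show ?thesis .
qed

lemma gauss_map_nonneg: "gauss_map x \<ge> 0" and gauss_map_less_1: "gauss_map x < 1"
  by (auto simp: gauss_map_eq_frac frac_lt_1)

text \<open>Half-lines \<open>{t<..}\<close> determine the measure. For \<open>t\<close> in
  \<open>[0,1)\<close> the preimage meets each branch of the Gauss map in an interval, and the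
  measures of these intervals telescope.\<close>

theorem gauss_measure_invariant: "distr gauss_measure gauss_measure gauss_map = gauss_measure"
proof (rule measure_eqI_lessThan)
  interpret G: prob_space gauss_measure by (rule prob_space_gauss_measure)
  have T: "gauss_map \<in> gauss_measure \<rightarrow>\<^sub>M gauss_measure" by measurable
  have eq: "emeasure (distr gauss_measure gauss_measure gauss_map) {t<..} =
      emeasure gauss_measure (gauss_map -` {t<..})" for t
    by (subst emeasure_distr[OF T]) auto
  show "emeasure (distr gauss_measure gauss_measure gauss_map) {t<..} < \<infinity>" for t
    unfolding eq using G.emeasure_finite[of "gauss_map -` {t<..}"] by (simp add: less_top[symmetric])
  show "emeasure (distr gauss_measure gauss_measure gauss_map) {t<..} = emeasure gauss_measure {t<..}" for t
  proof -
    consider "t < 0" | "t \<ge> 1" | "0 \<le> t" "t < 1" by linarith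
    then show ?thesis
    proof cases
      case 1
      have "gauss_map -` {t<..} = UNIV" using gauss_map_nonneg 1 by (auto intro: less_le_trans)
      moreover have "emeasure gauss_measure {t<..} = 1"
        using 1 by (subst emeasure_gauss_interval[where u=0 and v=1]) auto
      ultimately show ?thesis using G.emeasure_space_1 by (simp add: eq)
    next
      case 2
      have "gauss_map -` {t<..} = {}" using less_le_trans[OF gauss_map_less_1 2] by (auto dest: less_asym)
      moreover have "emeasure gauss_measure {t<..} = 0"
        using 2 by (subst emeasure_gauss_interval[where u=1 and v=1]) auto
      ultimately show ?thesis by (simp add: eq)
    next
      case 3
      \<comment> \<open>The index \<open>n\<close> stands for the partial quotient
        \<open>n + 1\<close>; the measure of \<open>?I n\<close> will be
        \<open>?h n - ?h (Suc n)\<close>, and \<open>?h 0\<close> is the measure of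
        \<open>{t<..}\<close>.\<close>
      let ?I = "\<lambda>n::nat. {1 / (real n + 2) <..< 1 / (real n + 1 + t)}"
      let ?h = "\<lambda>n::nat. (ln (real n + 2) - ln (real n + 1 + t)) / ln 2"
      have mem: "x \<in> ?I n \<longleftrightarrow> \<lfloor>1 / x\<rfloor> = int n + 1 \<and> gauss_map x > t" if "x \<in> {0<..<1}" for x n
        using gauss_map_branch[of x t "int n + 1"] that 3 by (auto simp: add.assoc)
      have I01: "?I n \<subseteq> {0<..<1}" for n
      proof
        fix x assume "x \<in> ?I n"
        then have x: "1 / (real n + 2) < x" "x < 1 / (real n + 1 + t)" by auto
        have "0 < 1 / (real n + 2)" by simp
        moreover have "1 / (real n + 1 + t) \<le> 1" using 3 by simp
        ultimately show "x \<in> {0<..<1}" using x by (simp only: greaterThanLessThan_iff) linarith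
      qed
      have "gauss_map -` {t<..} \<inter> {0<..<1} = (\<Union>n. ?I n)"
      proof (intro set_eqI iffI)
        fix x assume x: "x \<in> gauss_map -` {t<..} \<inter> {0<..<1}"
        then have "\<lfloor>1 / x\<rfloor> \<ge> 1" by (simp add: le_floor_iff)
        then have "\<lfloor>1 / x\<rfloor> = int (nat (\<lfloor>1 / x\<rfloor> - 1)) + 1" by simp
        then show "x \<in> (\<Union>n. ?I n)" using mem x by blast
      next
        fix x assume "x \<in> (\<Union>n. ?I n)"
        then show "x \<in> gauss_map -` {t<..} \<inter> {0<..<1}" using mem I01 by blast
      qed
      then have "emeasure gauss_measure (gauss_map -` {t<..}) = emeasure gauss_measure (\<Union>n. ?I n)"
        using emeasure_unit_density_Int[of "\<lambda>x. 1 / (ln 2 * (1 + x))" "gauss_map -` {t<..}"]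
          measurable_sets[OF gauss_map_measurable, of "{t<..}"] by (simp add: gauss_measure_def)
      also have "\<dots> = (\<Sum>n. emeasure gauss_measure (?I n))"
      proof (rule suminf_emeasure[symmetric])
        show "disjoint_family ?I"
        proof (unfold disjoint_family_on_def, intro ballI impI equals0I)
          fix m n x assume "m \<noteq> n" and x: "x \<in> ?I m \<inter> ?I n"
          have "x \<in> {0<..<1}" using I01[of m] x by blast
          with x show False using mem[of x m] mem[of x n] \<open>m \<noteq> n\<close> by simp
        qed
      qed auto
      also have "\<dots> = (\<Sum>n. ennreal (?h n - ?h (Suc n)))"
      proof (rule suminf_cong)
        fix n
        have "1 / (real n + 2) \<le> 1 / (real n + 1 + t)" using 3 by (intro divide_left_mono) auto
        moreover have "1 / (real n + 1 + t) \<le> 1" using 3 by simp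
        ultimately have "emeasure gauss_measure (?I n) =
            ennreal ((ln (1 + 1 / (real n + 1 + t)) - ln (1 + 1 / (real n + 2))) / ln 2)"
          using I01[of n] by (intro emeasure_gauss_interval) auto
        also have "1 + 1 / (real n + 1 + t) = (real n + 2 + t) / (real n + 1 + t)"
          using 3 by (simp add: field_simps)
        also have "1 + 1 / (real n + 2) = (real n + 3) / (real n + 2)" by (simp add: field_simps)
        also have "ln ((real n + 2 + t) / (real n + 1 + t)) = ln (real n + 2 + t) - ln (real n + 1 + t)"
          using 3 by (intro ln_divide_pos) auto
        also have "ln ((real n + 3) / (real n + 2)) = ln (real n + 3) - ln (real n + 2)"
          by (intro ln_divide_pos) auto
        finally show "emeasure gauss_measure (?I n) = ennreal (?h n - ?h (Suc n))"
          by (simp add: diff_divide_distrib add_divide_distrib algebra_simps)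
      qed
      also have "\<dots> = ennreal (?h 0)"
      proof (rule suminf_ennreal_eq)
        have "?h \<longlonglongrightarrow> 0"
        proof -
          have "(\<lambda>n. ln ((real n + 2) / (real n + 1 + t)) / ln 2) \<longlonglongrightarrow> ln 1 / ln 2"
          proof (intro tendsto_intros)
            show "(\<lambda>n. (real n + 2) / (real n + 1 + t)) \<longlonglongrightarrow> 1" by real_asymp
          qed auto
          moreover have "ln ((real n + 2) / (real n + 1 + t)) = ln (real n + 2) - ln (real n + 1 + t)" for n
            using 3 by (intro ln_divide_pos) auto
          ultimately show ?thesis by simp
        qed
        then show "(\<lambda>n. ?h n - ?h (Suc n)) sums ?h 0" using telescope_sums'[of ?h 0] by simp
        show "?h n - ?h (Suc n) \<ge> 0" for n
        proof -
          have "ln (real n + 3) + ln (real n + 1 + t) \<le> ln (real n + 2) + ln (real n + 2 + t)"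
          proof -
            \<comment> \<open>The right side exceeds the left by exactly
              \<open>1 - t\<close>.\<close>
            have "(real n + 3) * (real n + 1 + t) \<le> (real n + 2) * (real n + 2 + t)"
              using 3 by (simp add: algebra_simps)
            then have "ln ((real n + 3) * (real n + 1 + t)) \<le> ln ((real n + 2) * (real n + 2 + t))"
              using 3 by (subst ln_le_cancel_iff) auto
            then show ?thesis using 3 by (simp add: ln_mult_pos)
          qed
          then show ?thesis by (simp add: diff_divide_distrib[symmetric] algebra_simps divide_right_mono)
        qed
      qed
      also have "?h 0 = (ln (1 + 1) - ln (1 + t)) / ln 2" by simp
      also have "ennreal \<dots> = emeasure gauss_measure {t<..}"
        using 3 by (intro emeasure_gauss_interval[symmetric]) auto
      finally show ?thesis by (simp add: eq)
    qed
  qed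
qed auto

section \<open>Cylinder laws under one step of the Gauss map\<close>

definition gauss_cell :: "int \<Rightarrow> real set" where
  "gauss_cell a = {x\<in>{0<..<1}. \<lfloor>1 / x\<rfloor> = a}"

lemma gauss_cell_measurable [measurable]: "gauss_cell a \<in> sets borel"
  unfolding gauss_cell_def by measurable

text \<open>Substituting \<open>x = 1 / (a + y)\<close> turns the density of
  \<open>cylinder_law c\<close> into \<open>(1 + c) / (a + c + y)\<^sup>2\<close>, a multiple of the
  density with parameter \<open>1 / (a + c)\<close>. The passage from \<open>c\<close> to
  \<open>1 / (a + c)\<close> is the recursion of the ratio of consecutive continued fraction
  denominators.\<close>

lemma cylinder_law_gauss_cell:
  assumes c: "0 \<le> c" and a: "a \<ge> 1" and B [measurable]: "B \<in> sets borel"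
  shows "emeasure (cylinder_law c) (gauss_cell a \<inter> gauss_map -` B) =
    ennreal ((1 + c) / ((of_int a + c) * (of_int a + 1 + c))) * emeasure (cylinder_law (1 / (of_int a + c))) B"
proof -
  define w where "w = (1 + c) / ((of_int a + c) * (of_int a + 1 + c))"
  define c' where "c' = 1 / (of_int a + c)"
  have a': "of_int a \<ge> (1::real)" using a by simp
  have w: "w \<ge> 0" and c': "c' \<ge> 0" using c a' by (auto simp: w_def c'_def)
  interpret C: prob_space "cylinder_law c" by (rule prob_space_cylinder_law[OF c])
  \<comment> \<open>The left side becomes a measure in \<open>B\<close>, so that comparison on
    half-lines extends to all Borel sets.\<close>
  define P where "P = distr (density (cylinder_law c) (indicator (gauss_cell a))) borel gauss_map"
  have P: "emeasure P B = emeasure (cylinder_law c) (gauss_cell a \<inter> gauss_map -` B)" if [measurable]: "B \<in> sets borel" for B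
  proof -
    have m: "gauss_map -` B \<in> sets (cylinder_law c)"
      using measurable_sets[OF gauss_map_measurable that] by simp
    have "emeasure P B = emeasure (density (cylinder_law c) (indicator (gauss_cell a))) (gauss_map -` B)"
      unfolding P_def by (subst emeasure_distr) auto
    also have "\<dots> = emeasure (cylinder_law c) (gauss_cell a \<inter> gauss_map -` B)"
      by (rule emeasure_restricted) (use m in auto)
    finally show ?thesis .
  qed
  have "P = scale_measure (ennreal w) (cylinder_law c')"
  proof (rule measure_eqI_lessThan)
    show "emeasure P {t<..} < \<infinity>" for t
      by (simp add: P less_top[symmetric] C.emeasure_finite)
    show "emeasure P {t<..} = emeasure (scale_measure (ennreal w) (cylinder_law c')) {t<..}" for t
    proof (cases "t < 1")
      case False
      have "gauss_map -` {t<..} = {}" using less_le_trans[OF gauss_map_less_1, of t] False by (auto simp: not_less dest: less_asym)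
      moreover have "emeasure (cylinder_law c') {t<..} = 0"
        using False c' by (subst emeasure_cylinder_law_interval[where u=1 and v=1]) auto
      ultimately show ?thesis by (simp add: P)
    next
      case True
      \<comment> \<open>For negative \<open>t\<close> the condition \<open>gauss_map x > t\<close>
        is void, and the set differs from the one for 0 by at most an endpoint.\<close>
      define s where "s = max 0 t"
      have s: "0 \<le> s" "s < 1" using True by (auto simp: s_def)
      define u v :: real where "u = 1 / (of_int a + 1)" and "v = 1 / (of_int a + s)"
      have uv: "0 \<le> u" "u \<le> v" "v \<le> 1" using a' s by (auto simp: u_def v_def intro!: divide_left_mono)
      have m: "gauss_cell a \<inter> gauss_map -` {t<..} \<in> sets borel"
        using measurable_sets[OF gauss_map_measurable, of "{t<..}"] by auto
      have "{u<..<v} \<subseteq> gauss_cell a \<inter> gauss_map -` {t<..} \<inter> {0<..<1}"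
      proof
        fix x assume x: "x \<in> {u<..<v}"
        then have "0 < x" "x < 1" using uv by auto
        with x show "x \<in> gauss_cell a \<inter> gauss_map -` {t<..} \<inter> {0<..<1}"
          using gauss_map_branch[of x s a] s a by (auto simp: gauss_cell_def u_def v_def s_def)
      qed
      moreover have "gauss_cell a \<inter> gauss_map -` {t<..} \<inter> {0<..<1} \<subseteq> {u..v}"
      proof
        fix x assume x: "x \<in> gauss_cell a \<inter> gauss_map -` {t<..} \<inter> {0<..<1}"
        then have "gauss_map x \<ge> s" using gauss_map_nonneg[of x] by (auto simp: s_def)
        then have "of_int a + s \<le> 1 / x" "1 / x < of_int a + 1" 
          using x floor_correct[of "1 / x"] by (auto simp: gauss_cell_def gauss_map_def)
        then show "x \<in> {u..v}" using x a' s by (auto simp: u_def v_def field_simps)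
      qed
      ultimately have "emeasure P {t<..} = ennreal ((1 + c) * (v - u) / ((1 + c * u) * (1 + c * v)))"
        by (subst P) (use c uv m in \<open>auto intro!: emeasure_cylinder_law_interval\<close>)
      also have "(1 + c) * (v - u) / ((1 + c * u) * (1 + c * v)) = w * ((1 + c') * (1 - s) / ((1 + c' * s) * (1 + c' * 1)))"
      proof -
        \<comment> \<open>In these variables both sides reduce to
          \<open>(1 + c) * (1 - s) / ((p + 1) * (p + s))\<close>.\<close>
        define p q where "p = of_int a + c" and "q = of_int a + s"
        have pos: "p > 0" "q > 0" "of_int a + 1 > (0::real)" "p + 1 > 0" "p + s > 0"
          using a' c s by (auto simp: p_def q_def)
        have "v - u = (1 - s) / ((of_int a + 1) * q)"
          using pos by (simp add: u_def v_def q_def[symmetric] divide_simps) (simp add: q_def)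
        moreover have "1 + c * u = (p + 1) / (of_int a + 1)"
          using pos by (simp add: u_def p_def field_simps)
        moreover have "1 + c * v = (p + s) / q"
          using pos by (simp add: v_def p_def q_def field_simps)
        moreover have c'p: "c' = 1 / p" by (simp add: c'_def p_def)
        moreover have "1 + c' * s = (p + s) / p" "1 + c' * 1 = (p + 1) / p"
          using pos by (simp_all add: c'p field_simps)
        moreover have "w = (1 + c) / (p * (p + 1))" by (simp add: w_def p_def algebra_simps)
        moreover have "1 + c' = (p + 1) / p" using pos by (simp add: c'p field_simps)
        ultimately have "(1 + c) * (v - u) / ((1 + c * u) * (1 + c * v)) =
            (1 + c) * ((1 - s) / ((of_int a + 1) * q)) / ((p + 1) / (of_int a + 1) * ((p + s) / q))"
          "w * ((1 + c') * (1 - s) / ((1 + c' * s) * (1 + c' * 1))) =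
            (1 + c) / (p * (p + 1)) * ((p + 1) / p * (1 - s) / ((p + s) / p * ((p + 1) / p)))"
          by simp_all
        moreover have "K * (L / (b * q)) / (m / b * (r / q)) = K / (p * m) * (m / p * L / (r / p * (m / p)))"
          if "b > 0" "m > 0" "r > 0" for K L b m r :: real
          using that pos by (simp add: divide_simps)
        ultimately show ?thesis using pos by metis
      qed
      also have "ennreal \<dots> = ennreal w * emeasure (cylinder_law c') {t<..}"
      proof -
        have "emeasure (cylinder_law c') {t<..} = ennreal ((1 + c') * (1 - s) / ((1 + c' * s) * (1 + c' * 1)))"
          using c' s by (intro emeasure_cylinder_law_interval) (auto simp: s_def)
        then show ?thesis using w by (simp only: ennreal_mult')
      qed
      finally show ?thesis by simp
    qed
  qed (simp_all add: P_def)
  then show ?thesis using P[OF B] by (simp add: w_def c'_def)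
qed

text \<open>\<open>cylinder_law 0\<close> is Lebesgue measure on the unit interval, and the density
  of \<open>cylinder_law c\<close> there is at least \<open>1 / (1 + c)\<close>, hence at least 1/2.
  That the bound is uniform in \<open>c\<close> is what ergodicity rests on.\<close>

lemma cylinder_law_ge_half:
  assumes c: "0 \<le> c" "c \<le> 1" and B [measurable]: "B \<in> sets borel"
  shows "emeasure (cylinder_law c) B \<ge> ennreal (1/2) * emeasure (cylinder_law 0) B"
proof -
  have "ennreal (1/2) * emeasure (cylinder_law 0) B = emeasure (unit_density (\<lambda>x. 1/2)) B"
    unfolding cylinder_law_def unit_density_def
    by (subst (1 2) emeasure_density) (auto simp: nn_integral_cmult[symmetric] indicator_def ennreal_mult'[symmetric] intro!: nn_integral_cong)
  also have "\<dots> \<le> emeasure (cylinder_law c) B"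
    unfolding cylinder_law_def
  proof (rule unit_density_mono)
    fix x :: real assume x: "x \<in> {0<..<1}"
    have "(1 + c * x)\<^sup>2 \<le> (1 + c)\<^sup>2" using x c by (intro power_mono) (auto simp: mult_left_le)
    also have "\<dots> \<le> 2 * (1 + c)" unfolding power2_eq_square using c by (intro mult_right_mono) auto
    finally have "(1 + c * x)\<^sup>2 \<le> 2 * (1 + c)" .
    moreover have "(1 + c * x)\<^sup>2 > 0" using x c by (intro zero_less_power add_pos_nonneg) auto
    ultimately show "1 / 2 \<le> (1 + c) / (1 + c * x)\<^sup>2" by (simp add: divide_simps)
  qed auto
  finally show ?thesis .
qed


subsection \<open>Cylinders of the continued fraction expansion\<close>

definition irrationals01 :: "real set" where
  "irrationals01 = {0<..<1} - \<rat>"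

lemma irrationals01_measurable [measurable]: "irrationals01 \<in> sets borel"
  unfolding irrationals01_def by (auto intro!: sets.Diff sets.countable[OF _ countable_rat])

definition quotient_word :: "nat \<Rightarrow> real \<Rightarrow> int list" where
  "quotient_word n x = map (\<lambda>i. partial_quotient i x) [1..<Suc n]"

lemma length_quotient_word [simp]: "length (quotient_word n x) = n"
  by (simp add: quotient_word_def)

lemma quotient_word_0 [simp]: "quotient_word 0 x = []"
  by (simp add: quotient_word_def)

lemma partial_quotient_Suc: "partial_quotient (Suc i) x = \<lfloor>1 / (gauss_map ^^ i) x\<rfloor>"
  by (simp add: partial_quotient_def)

lemma quotient_word_Suc: "quotient_word (Suc n) x = \<lfloor>1 / x\<rfloor> # quotient_word n (gauss_map x)"
proof -
  have word: "quotient_word n x = map (\<lambda>i. \<lfloor>1 / (gauss_map ^^ i) x\<rfloor>) [0..<n]" for n x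
  proof -
    have "[1..<Suc n] = map Suc [0..<n]" by (simp add: map_Suc_upt)
    then show ?thesis by (simp add: quotient_word_def partial_quotient_Suc)
  qed
  show ?thesis unfolding word
    by (simp only: upt_conv_Cons[OF zero_less_Suc] list.map map_Suc_upt[symmetric] map_map)
       (simp add: funpow_swap1)
qed

lemma quotient_word_snoc: "quotient_word (Suc n) x = quotient_word n x @ [partial_quotient (Suc n) x]"
  by (simp add: quotient_word_def)

lemma gauss_map_irrationals01: "gauss_map x \<in> irrationals01" if "x \<in> irrationals01"
  using gauss_map_iterate_irrational[of x 1] that by (auto simp: irrationals01_def)

lemma floor_inverse_irrationals01: "\<lfloor>1 / x\<rfloor> \<ge> 1" if "x \<in> irrationals01"
  using that by (auto simp: irrationals01_def le_floor_iff)

text \<open>Irrational points have orbits that never reach 0, so all their partial quotients are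
  genuine; a word with an entry below 1 has an empty cylinder.\<close>

definition cylinder :: "int list \<Rightarrow> real set" where
  "cylinder w = {x \<in> irrationals01. quotient_word (length w) x = w}"

lemma cylinder_Nil: "cylinder [] = irrationals01"
  by (simp add: cylinder_def)

lemma cylinder_Cons: "cylinder (a # w) = gauss_cell a \<inter> gauss_map -` cylinder w"
proof (intro set_eqI iffI)
  fix x assume x: "x \<in> gauss_cell a \<inter> gauss_map -` cylinder w"
  have "x \<notin> \<rat>"
  proof
    assume "x \<in> \<rat>"
    then have "gauss_map x \<in> \<rat>" by (auto simp: gauss_map_def)
    then show False using x by (auto simp: cylinder_def irrationals01_def)
  qed
  then show "x \<in> cylinder (a # w)"
    using x by (auto simp: cylinder_def irrationals01_def gauss_cell_def quotient_word_Suc)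
qed (auto simp: cylinder_def gauss_map_irrationals01 gauss_cell_def quotient_word_Suc, auto simp: irrationals01_def)

lemma cylinder_measurable [measurable]: "cylinder w \<in> sets borel"
proof (induction w)
  case (Cons a w)
  then show ?case
    using measurable_sets[OF gauss_map_measurable, of "cylinder w"] by (simp add: cylinder_Cons)
qed (simp add: cylinder_Nil)

lemma cylinder_ge_1: "x \<in> cylinder w \<Longrightarrow> \<forall>a\<in>set w. a \<ge> 1"
  by (induction w arbitrary: x) 
     (auto simp: cylinder_Cons gauss_cell_def le_floor_iff)

text \<open>Iterating \<open>cylinder_law_gauss_cell\<close> along the word shows that, given the
  cylinder, the iterate of the point again has a cylinder law. Its parameter stays in
  \<open>[0,1]\<close> because \<open>1 / (a + c)\<close> does for \<open>a \<ge> 1\<close> and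
  \<open>c \<ge> 0\<close>.\<close>

lemma cylinder_law_cylinder:
  assumes "0 \<le> c" "c \<le> 1" "\<forall>a\<in>set w. a \<ge> 1"
  shows "\<exists>c'. 0 \<le> c' \<and> c' \<le> 1 \<and> (\<forall>B\<in>sets borel.
    emeasure (cylinder_law c) (cylinder w \<inter> (gauss_map ^^ length w) -` B) =
    emeasure (cylinder_law c) (cylinder w) * emeasure (cylinder_law c') B)"
  using assms
proof (induction w arbitrary: c)
  case Nil
  have "emeasure (cylinder_law c) (irrationals01 \<inter> B) = emeasure (cylinder_law c) B"
    if B [measurable]: "B \<in> sets borel" for B
  proof -
    have "(\<rat> :: real set) \<in> null_sets lborel" by (intro countable_imp_null_set_lborel countable_rat)
    then have "AE x in lborel. x \<notin> (\<rat> :: real set)" by (rule AE_not_in)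
    then have "emeasure (cylinder_law c) (irrationals01 \<inter> B) = emeasure (cylinder_law c) (B \<inter> {0<..<1})"
      unfolding cylinder_law_def unit_density_def
      using irrationals01_measurable
      by (intro emeasure_eq_AE) (auto simp: AE_density irrationals01_def elim!: eventually_mono)
    also have "\<dots> = emeasure (cylinder_law c) B"
      unfolding cylinder_law_def by (rule emeasure_unit_density_Int[symmetric]) auto
    finally show ?thesis .
  qed
  note * = this
  have "emeasure (cylinder_law c) irrationals01 = 1"
    using *[of UNIV] prob_space.emeasure_space_1[OF prob_space_cylinder_law] Nil by simp
  then show ?case using Nil * by (intro exI[of _ c]) (auto simp: cylinder_Nil)
next
  case (Cons a w)
  let ?c = "1 / (of_int a + c)"
  let ?W = "ennreal ((1 + c) / ((of_int a + c) * (of_int a + 1 + c)))"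
  have a: "of_int a \<ge> (1::real)" using Cons.prems by simp
  have c1: "0 \<le> ?c" "?c \<le> 1" using a Cons.prems by auto
  obtain c' where c': "0 \<le> c'" "c' \<le> 1" and IH: "\<And>B. B \<in> sets borel \<Longrightarrow>
     emeasure (cylinder_law ?c) (cylinder w \<inter> (gauss_map ^^ length w) -` B) =
     emeasure (cylinder_law ?c) (cylinder w) * emeasure (cylinder_law c') B"
    using Cons.IH[OF c1] Cons.prems by auto
  have "emeasure (cylinder_law c) (cylinder (a # w) \<inter> (gauss_map ^^ length (a # w)) -` B) =
    emeasure (cylinder_law c) (cylinder (a # w)) * emeasure (cylinder_law c') B" if B [measurable]: "B \<in> sets borel" for B
  proof -
    have [measurable]: "cylinder w \<inter> (gauss_map ^^ length w) -` B \<in> sets borel"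
      using measurable_sets[OF measurable_compose_n[OF gauss_map_measurable] B, of "length w"] by auto
    have "cylinder (a # w) \<inter> (gauss_map ^^ length (a # w)) -` B
        = gauss_cell a \<inter> gauss_map -` (cylinder w \<inter> (gauss_map ^^ length w) -` B)"
      by (auto simp: cylinder_Cons funpow_swap1)
    then have "emeasure (cylinder_law c) (cylinder (a # w) \<inter> (gauss_map ^^ length (a # w)) -` B) =
        ?W * emeasure (cylinder_law ?c) (cylinder w \<inter> (gauss_map ^^ length w) -` B)"
      using cylinder_law_gauss_cell[of c a "cylinder w \<inter> (gauss_map ^^ length w) -` B"] Cons.prems by simp
    also have "\<dots> = ?W * emeasure (cylinder_law ?c) (cylinder w) * emeasure (cylinder_law c') B"
      by (simp add: IH mult.assoc)
    also have "?W * emeasure (cylinder_law ?c) (cylinder w) = emeasure (cylinder_law c) (cylinder (a # w))"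
      using cylinder_law_gauss_cell[of c a "cylinder w"] Cons.prems by (simp add: cylinder_Cons)
    finally show ?thesis .
  qed
  then show ?case using c' by blast
qed

section \<open>Approximation by convergents\<close>

lemma of_rat_cfrac_value_Cons:
  "of_rat (cfrac_value (a # w)) = 1 / (of_int a + of_rat (cfrac_value w) :: real)"
  by (simp add: of_rat_divide of_rat_add)

lemma of_rat_cfrac_value_bounds:
  "\<forall>a\<in>set w. a \<ge> 1 \<Longrightarrow> of_rat (cfrac_value w) \<in> {0..1::real}"
proof (induction w)
  case (Cons a w)
  then have "of_int a \<ge> (1::real)" "of_rat (cfrac_value w) \<ge> (0::real)" by auto
  then have "1 \<le> of_int a + real_of_rat (cfrac_value w)" by linarith
  then have "1 / (of_int a + real_of_rat (cfrac_value w)) \<in> {0..1}" by simp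
  then show ?case unfolding of_rat_cfrac_value_Cons .
qed simp

lemma cfrac_convergent_eq: "cfrac_convergent n x = cfrac_value (quotient_word n x)"
  by (simp add: cfrac_convergent_def quotient_word_def)

text \<open>With \<open>u = gauss_map x\<close> the product is \<open>u / (k + u)\<close>, where
  \<open>u < 1 \<le> k\<close>. A single factor may be close to 1, so contraction shows only over
  two steps.\<close>

lemma gauss_map_mult_le: "x * gauss_map x \<le> 1 / 2" if "x \<in> irrationals01"
proof -
  define k where "k = real_of_int \<lfloor>1 / x\<rfloor>"
  define u where "u = gauss_map x"
  have "x \<noteq> 0" using that by (auto simp: irrationals01_def)
  then have "x = 1 / (k + u)" by (simp add: u_def k_def gauss_map_def)
  moreover have "k \<ge> 1" using floor_inverse_irrationals01[OF that] by (simp add: k_def)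
  moreover have "0 \<le> u" "u < 1" using gauss_map_nonneg gauss_map_less_1 by (simp_all add: u_def)
  ultimately have "x * u = u / (k + u)" "u / (k + u) \<le> 1 / 2" by (simp_all add: divide_simps)
  then show ?thesis unfolding u_def[symmetric] by linarith
qed

text \<open>The identity \<open>1/(a+u) - 1/(a+v) = (v-u)/((a+u)(a+v))\<close> propagates the error of the convergent.\<close>

lemma cfrac_error_step:
  fixes x :: real and n :: nat
  assumes x: "x \<in> irrationals01"
  defines "c \<equiv> real_of_rat (cfrac_convergent (Suc n) x)"
  shows "\<bar>x - c\<bar> = x * c * \<bar>gauss_map x - of_rat (cfrac_convergent n (gauss_map x))\<bar>"
    and "0 < c" "c \<le> 1"
    and "c * of_rat (cfrac_convergent n (gauss_map x)) \<le> 1 / 2"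
    and "\<bar>ln x - ln c\<bar> \<le> \<bar>gauss_map x - of_rat (cfrac_convergent n (gauss_map x))\<bar>"
proof -
  define a where "a = real_of_int \<lfloor>1 / x\<rfloor>"
  define u where "u = gauss_map x"
  define v :: real where "v = of_rat (cfrac_convergent n (gauss_map x))"
  have x01: "0 < x" "x < 1" using x by (auto simp: irrationals01_def)
  have a: "a \<ge> 1" using floor_inverse_irrationals01[OF x] by (simp add: a_def)
  have u: "0 < u" "u < 1" using gauss_map_irrationals01[OF x] by (auto simp: u_def irrationals01_def)
  \<comment> \<open>A point lies in the cylinder of its own word, so the word has entries at least 1
    and \<open>v\<close> lies in \<open>[0,1]\<close>.\<close>
  have "gauss_map x \<in> cylinder (quotient_word n (gauss_map x))"
    using gauss_map_irrationals01[OF x] by (simp add: cylinder_def)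
  then have v: "0 \<le> v" "v \<le> 1"
    using of_rat_cfrac_value_bounds[OF cylinder_ge_1] by (auto simp: v_def cfrac_convergent_eq)
  have xu: "x = 1 / (a + u)" using x01 by (simp add: u_def a_def gauss_map_def)
  have cv: "c = 1 / (a + v)"
    by (simp add: c_def v_def cfrac_convergent_eq quotient_word_Suc of_rat_cfrac_value_Cons a_def del: cfrac_value.simps)
  have pos: "a + u > 0" "a + v > 0" using a u v by linarith+
  have "x - c = (v - u) * (x * c)" using pos by (simp add: xu cv divide_simps)
  then show "\<bar>x - c\<bar> = x * c * \<bar>gauss_map x - of_rat (cfrac_convergent n (gauss_map x))\<bar>"
    using x01 pos unfolding v_def[symmetric] unfolding u_def[symmetric]
    by (simp add: abs_mult abs_minus_commute cv)
  show c: "0 < c" "c \<le> 1" using a v by (auto simp: cv)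

  show "c * of_rat (cfrac_convergent n (gauss_map x)) \<le> 1 / 2"
    using a v pos unfolding v_def[symmetric] by (simp add: cv divide_simps)
  have ln_bound: "ln (a + s) - ln (a + t) \<le> \<bar>s - t\<bar>" if "a + s > 0" "t \<ge> 0" for s t
  proof -
    have "ln (a + s) - ln (a + t) \<le> ((a + s) - (a + t)) / (a + t)"
      using ln_diff_le[of "a + s" "a + t"] that a by auto
    also have "\<dots> \<le> \<bar>s - t\<bar> / (a + t)" using that a by (intro divide_right_mono) auto
    also have "\<dots> \<le> \<bar>s - t\<bar>" using that a by (simp add: divide_le_eq mult_left_mono[of 1 "a + t" "\<bar>s - t\<bar>", simplified])
    finally show ?thesis .
  qed
  have "ln x - ln c = ln (a + v) - ln (a + u)"
    using pos by (simp add: xu cv ln_divide_pos)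
  then show "\<bar>ln x - ln c\<bar> \<le> \<bar>gauss_map x - of_rat (cfrac_convergent n (gauss_map x))\<bar>"
    using ln_bound[of u v] ln_bound[of v u] u v pos unfolding v_def[symmetric] unfolding u_def[symmetric] by (simp add: abs_le_iff)
qed

text \<open>Two applications of \<open>cfrac_error_step\<close> multiply the error by two products,
  each at most 1/2; hence the induction in steps of two.\<close>

lemma cfrac_error_le:
  "x \<in> irrationals01 \<Longrightarrow> \<bar>x - of_rat (cfrac_convergent n x)\<bar> \<le> 2 * (1 / 2) ^ n"
proof (induction n arbitrary: x rule: induct_nat_012)
  case 0
  then show ?case by (auto simp: cfrac_convergent_eq irrationals01_def)
next
  case 1
  have "0 < x" "x < 1" using 1 by (auto simp: irrationals01_def)
  then have "\<bar>x - of_rat (cfrac_convergent (Suc 0) x)\<bar> \<le> 1"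
    using cfrac_error_step(2,3)[OF 1, of 0] by linarith
  then show ?case by simp
next
  case (ge2 n)
  let ?y = "gauss_map x" and ?z = "gauss_map (gauss_map x)"
  let ?c = "\<lambda>n x. real_of_rat (cfrac_convergent n x)"
  note y = gauss_map_irrationals01[OF ge2.prems]
  note z = gauss_map_irrationals01[OF y]
  note ex = cfrac_error_step[OF ge2.prems, of "Suc n"] and ey = cfrac_error_step[OF y, of n]
  have x01: "0 < x" "0 < ?y" using ge2.prems y by (auto simp: irrationals01_def)
  have "\<bar>x - ?c (Suc (Suc n)) x\<bar> = (x * ?y) * (?c (Suc (Suc n)) x * ?c (Suc n) ?y) * \<bar>?z - ?c n ?z\<bar>"
    by (simp add: ex(1) ey(1))
  also have "\<dots> \<le> (1 / 2) * (1 / 2) * (2 * (1 / 2) ^ n)"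
    using ex(2-4) ey(2,3) ge2.IH(1)[OF z] x01 gauss_map_mult_le[OF ge2.prems] by (intro mult_mono) auto
  finally show ?case by simp
qed


subsection \<open>Ergodicity of the Gauss map\<close>

lemma cylinder_law_0:
  assumes [measurable]: "B \<in> sets borel"
  shows "emeasure (cylinder_law 0) B = emeasure lborel (B \<inter> {0<..<1})"
proof -
  have "emeasure (cylinder_law 0) B = (\<integral>\<^sup>+x. indicator (B \<inter> {0<..<1}) x \<partial>lborel)"
    unfolding cylinder_law_def unit_density_def
    by (subst emeasure_density, simp, simp, rule nn_integral_cong) (auto simp: indicator_def)
  also have "\<dots> = emeasure lborel (B \<inter> {0<..<1})" by (rule nn_integral_indicator) simp
  finally show ?thesis .
qed

text \<open>Both points are close to the common convergent \<open>cfrac_value w\<close>.\<close>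

lemma cylinder_diameter:
  assumes "x \<in> cylinder w" "y \<in> cylinder w"
  shows "\<bar>x - y\<bar> \<le> 4 * (1 / 2) ^ length w"
proof -
  have "\<bar>z - of_rat (cfrac_value w)\<bar> \<le> 2 * (1 / 2) ^ length w" if "z \<in> cylinder w" for z
    using cfrac_error_le[of z "length w"] that by (simp add: cylinder_def cfrac_convergent_eq)
  from this[OF assms(1)] this[OF assms(2)] show ?thesis by linarith
qed

text \<open>Since \<open>A\<close> equals its preimage under every iterate, it fills each cylinder
  in proportion \<open>cylinder_law c' A\<close>, at least half of its own Lebesgue measure. The
  cylinders of order \<open>n\<close> inside \<open>U\<close> are disjoint and exhaust
  \<open>U\<close> within the unit interval up to a null set.\<close>

lemma cylinder_law_0_invariant_open:
  assumes A [measurable]: "A \<in> sets borel" and inv: "gauss_map -` A = A" and U: "open U"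
  shows "emeasure (cylinder_law 0) (U \<inter> A) \<ge>
    ennreal (1 / 2) * emeasure (cylinder_law 0) A * emeasure (cylinder_law 0) U"
proof -
  let ?L = "cylinder_law 0"
  define W where "W n = {w. length w = n \<and> cylinder w \<subseteq> U}" for n :: nat
  define V where "V n = (\<Union>w\<in>W n. cylinder w)" for n
  have countable_W: "countable (W n)" for n by simp
  have [measurable]: "U \<in> sets borel" using U by simp
  have V [measurable]: "V n \<in> sets borel" for n
    unfolding V_def using countable_W by (intro sets.countable_UN') auto
  have disj: "disjoint_family_on (\<lambda>w. cylinder w \<inter> S) (W n)" for n S
    unfolding disjoint_family_on_def W_def cylinder_def by auto
  have inv_n: "(gauss_map ^^ n) -` A = A" for n
  proof (induction n)
    case (Suc n)
    have "(gauss_map ^^ Suc n) -` A = gauss_map -` ((gauss_map ^^ n) -` A)" by (auto simp: funpow_swap1)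
    then show ?case by (simp only: Suc inv)
  qed simp
  have cyl: "ennreal (1 / 2) * emeasure ?L A * emeasure ?L (cylinder w) \<le> emeasure ?L (cylinder w \<inter> A)" for w
  proof (cases "cylinder w = {}")
    case False
    then have "\<forall>a\<in>set w. a \<ge> 1" using cylinder_ge_1 by blast
    from cylinder_law_cylinder[of 0, OF _ _ this] obtain c' where c': "0 \<le> c'" "c' \<le> 1"
      and eq: "\<And>B. B \<in> sets borel \<Longrightarrow> emeasure ?L (cylinder w \<inter> (gauss_map ^^ length w) -` B) =
         emeasure ?L (cylinder w) * emeasure (cylinder_law c') B" by auto
    have "ennreal (1 / 2) * emeasure ?L A * emeasure ?L (cylinder w) \<le> emeasure (cylinder_law c') A * emeasure ?L (cylinder w)"
      by (intro mult_right_mono cylinder_law_ge_half c' A) auto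
    also have "\<dots> = emeasure ?L (cylinder w \<inter> A)" using eq[OF A] by (simp add: inv_n mult.commute)
    finally show ?thesis .
  qed simp
  have V_le: "ennreal (1 / 2) * emeasure ?L A * emeasure ?L (V n) \<le> emeasure ?L (U \<inter> A)" for n
  proof -
    have "ennreal (1 / 2) * emeasure ?L A * emeasure ?L (V n) =
        ennreal (1 / 2) * emeasure ?L A * (\<integral>\<^sup>+w. emeasure ?L (cylinder w) \<partial>count_space (W n))"
      unfolding V_def using countable_W disj[of UNIV n] by (subst emeasure_UN_countable) auto
    also have "\<dots> = (\<integral>\<^sup>+w. ennreal (1 / 2) * emeasure ?L A * emeasure ?L (cylinder w) \<partial>count_space (W n))"
      by (rule nn_integral_cmult[symmetric]) auto
    also have "\<dots> \<le> (\<integral>\<^sup>+w. emeasure ?L (cylinder w \<inter> A) \<partial>count_space (W n))"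
      by (intro nn_integral_mono cyl)
    also have "\<dots> = emeasure ?L (\<Union>w\<in>W n. cylinder w \<inter> A)"
      using countable_W disj[of A n] by (intro emeasure_UN_countable[symmetric]) auto
    also have "\<dots> \<le> emeasure ?L (U \<inter> A)"
      by (intro emeasure_mono) (auto simp: W_def)
    finally show ?thesis .
  qed
  have "(\<lambda>n. emeasure ?L (V n)) \<longlonglongrightarrow> emeasure ?L (\<Union>n. V n)"
  proof (rule Lim_emeasure_incseq)
    show "incseq V"
    proof (rule incseq_SucI, rule subsetI)
      fix n x assume "x \<in> V n"
      then obtain w where w: "length w = n" "cylinder w \<subseteq> U" "x \<in> cylinder w" by (auto simp: V_def W_def)
      let ?w = "quotient_word (Suc n) x"
      have "cylinder ?w \<subseteq> cylinder w"
        using w(1,3) by (auto simp: cylinder_def quotient_word_snoc)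
      moreover have "x \<in> cylinder ?w" using w(3) by (auto simp: cylinder_def)
      ultimately show "x \<in> V (Suc n)" using w(2) by (auto simp: V_def W_def intro!: exI[of _ ?w])
    qed
  qed auto
  moreover have "(\<Union>n. V n) = U \<inter> irrationals01"
  proof (intro set_eqI iffI)
    fix x assume x: "x \<in> U \<inter> irrationals01"
    then obtain e where e: "e > 0" "ball x e \<subseteq> U" using U open_contains_ball by blast
    \<comment> \<open>This makes the diameter bound \<open>4 * (1 / 2) ^ n\<close> smaller than
      \<open>e\<close>.\<close>
    obtain n where n: "(1 / 2) ^ n < e / 4" using real_arch_pow_inv[of "e / 4" "1 / 2"] e by auto
    let ?w = "quotient_word n x"
    have xw: "x \<in> cylinder ?w" using x by (simp add: cylinder_def)
    have "cylinder ?w \<subseteq> ball x e"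
    proof
      fix y assume "y \<in> cylinder ?w"
      from cylinder_diameter[OF xw this] n show "y \<in> ball x e" by (simp add: dist_real_def)
    qed
    then have "?w \<in> W n" using e by (auto simp: W_def)
    then show "x \<in> (\<Union>n. V n)" using xw by (auto simp: V_def)
  qed (auto simp: V_def W_def cylinder_def)
  moreover have "emeasure ?L (U \<inter> irrationals01) = emeasure ?L U"
  proof -

    have "(\<rat> :: real set) \<in> null_sets lborel" by (intro countable_imp_null_set_lborel countable_rat)
    then have "AE x in lborel. x \<notin> (\<rat> :: real set)" by (rule AE_not_in)
    then have "emeasure lborel (U \<inter> irrationals01 \<inter> {0<..<1}) = emeasure lborel (U \<inter> {0<..<1})"
      using irrationals01_measurable by (intro emeasure_eq_AE) (auto simp: irrationals01_def)
    then show ?thesis by (simp add: cylinder_law_0)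
  qed
  ultimately have "(\<lambda>n. emeasure ?L (V n)) \<longlonglongrightarrow> emeasure ?L U" by simp
  then have "(\<lambda>n. ennreal (1 / 2) * emeasure ?L A * emeasure ?L (V n)) \<longlonglongrightarrow> ennreal (1 / 2) * emeasure ?L A * emeasure ?L U"
  proof (rule ennreal_tendsto_cmult[rotated])
    have "ennreal (1 / 2) * emeasure ?L A \<le> ennreal (1 / 2) * 1"
      using prob_space.emeasure_le_1[OF prob_space_cylinder_law[of 0], of A] by (intro mult_left_mono) auto
    also have "\<dots> < \<top>" using ennreal_less_top[of "1 / 2"] by (simp only: mult_1_right)
    finally show "ennreal (1 / 2) * emeasure ?L A < \<top>" .
  qed
  then show ?thesis using V_le by (intro LIMSEQ_le_const2) auto
qed

text \<open>An open \<open>U\<close> covering the complement of \<open>A\<close> in the unit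
  interval with excess below \<open>e\<close> meets \<open>A\<close> there only in that excess. The
  preceding bound then makes half the product of the measures of \<open>A\<close> and
  \<open>- A\<close> at most \<open>e\<close>, so the product vanishes.\<close>

lemma cylinder_law_0_invariant:
  assumes A [measurable]: "A \<in> sets borel" and inv: "gauss_map -` A = A"
  shows "emeasure (cylinder_law 0) A = 0 \<or> emeasure (cylinder_law 0) (- A) = 0"
proof -
  let ?L = "cylinder_law 0"
  let ?z = "ennreal (1 / 2) * emeasure ?L A * emeasure ?L (- A)"
  have "?z \<le> 0"
  proof (rule ennreal_le_epsilon)
    fix e :: real assume e: "e > 0"
    have "{0<..<1} - A \<in> sets borel" by simp
    from outer_regular_lborel[OF this e] obtain U where U: "open U" "{0<..<1} - A \<subseteq> U"
      "emeasure lborel (U - ({0<..<1} - A)) < ennreal e" by metis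
    have [measurable]: "U \<in> sets borel" using U by simp
    have "?z \<le> ennreal (1 / 2) * emeasure ?L A * emeasure ?L U"
    proof (rule mult_left_mono)
      show "emeasure ?L (- A) \<le> emeasure ?L U"
        using U(2) by (subst (1 2) cylinder_law_0) (auto intro!: emeasure_mono)
    qed simp
    also have "\<dots> \<le> emeasure ?L (U \<inter> A)"
      by (rule cylinder_law_0_invariant_open[OF A inv U(1)])
    also have "\<dots> \<le> emeasure lborel (U - ({0<..<1} - A))"
      by (subst cylinder_law_0) (auto intro!: emeasure_mono)
    also have "\<dots> \<le> ennreal e" using U(3) by simp
    finally show "?z \<le> 0 + ennreal e" by simp
  qed
  then show ?thesis by auto
qed

lemma AE_gauss_measure:
  "(AE x in gauss_measure. P x) \<longleftrightarrow> (AE x in lborel. x \<in> {0<..<1} \<longrightarrow> P x)"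
  unfolding gauss_measure_def by (rule AE_unit_density) auto

lemma gauss_measure_null:
  assumes [measurable]: "B \<in> sets borel" and null: "emeasure (cylinder_law 0) B = 0"
  shows "emeasure gauss_measure B = 0"
proof -
  have "AE x in lborel. x \<notin> B \<inter> {0<..<1}"
    using null by (intro AE_not_in) (auto simp: cylinder_law_0)
  then have "AE x in gauss_measure. x \<notin> B"
    unfolding AE_gauss_measure by eventually_elim auto
  then show ?thesis by (subst (asm) AE_iff_measurable[OF _ refl]) auto
qed

interpretation gauss: ergodic_map gauss_measure gauss_map
proof -
  interpret prob_space gauss_measure by (rule prob_space_gauss_measure)
  show "ergodic_map gauss_measure gauss_map"
  proof
    show "gauss_map \<in> gauss_measure \<rightarrow>\<^sub>M gauss_measure" by measurable
    show "distr gauss_measure gauss_measure gauss_map = gauss_measure" by (rule gauss_measure_invariant)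
    fix A assume A: "A \<in> sets gauss_measure" and inv: "gauss_map -` A \<inter> space gauss_measure = A"
    then have [measurable]: "A \<in> sets borel" by simp
    consider "emeasure gauss_measure A = 0" | "emeasure gauss_measure (- A) = 0"
      using cylinder_law_0_invariant[of A] inv gauss_measure_null[of A] gauss_measure_null[of "- A"] by auto
    then show "prob A = 0 \<or> prob A = 1"
    proof cases
      case 2
      then have "prob (space gauss_measure - A) = 0" by (simp add: measure_def Compl_eq_Diff_UNIV)
      then show ?thesis using prob_compl[OF A] by simp
    qed (simp add: measure_def)
  qed
qed

subsection \<open>The mean of the logarithm under the Gauss measure\<close>

lemma has_bochner_integral_power_ln:
  "has_bochner_integral lborel (\<lambda>x. indicator {0<..<1} x * (x ^ m * (- ln x))) (1 / (real m + 1)\<^sup>2)"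
proof -
  \<comment> \<open>The primitive from integration by parts; it tends to 0 at 0 and its first term
    gives the value at 1.\<close>
  define F where "F x = x ^ (m + 1) / (real m + 1)\<^sup>2 - x ^ (m + 1) * ln x / (real m + 1)" for x
  define f :: "real \<Rightarrow> real" where "f x = x ^ m * (- ln x)" for x
  have E: "einterval 0 1 = {0<..<1}"
    by (auto simp: einterval_def zero_ereal_def one_ereal_def)
  have F: "(F has_real_derivative f x) (at x)" if "0 < x" for x
  proof -
    have P: "((\<lambda>x. x ^ (m + 1)) has_real_derivative (real m + 1) * x ^ m) (at x)"
      using DERIV_pow[of "m + 1" x] by (simp add: add.commute)
    have "((\<lambda>x. x ^ (m + 1) / (real m + 1)\<^sup>2 - x ^ (m + 1) * ln x / (real m + 1)) has_real_derivative
      (real m + 1) * x ^ m / (real m + 1)\<^sup>2 - ((real m + 1) * x ^ m * ln x + 1 / x * x ^ (m + 1)) / (real m + 1)) (at x)"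
      by (intro DERIV_diff DERIV_cdivide DERIV_mult P DERIV_ln_divide that)
    also have "(real m + 1) * x ^ m / (real m + 1)\<^sup>2 - ((real m + 1) * x ^ m * ln x + 1 / x * x ^ (m + 1)) / (real m + 1) = f x"
      using that by (simp add: f_def power2_eq_square add_divide_distrib)
    finally show ?thesis unfolding F_def[abs_def] .
  qed
  have lim0: "(F \<longlongrightarrow> 0) (at_right 0)"
    unfolding F_def[abs_def] by real_asymp
  have lim1: "(F \<longlongrightarrow> F 1) (at_left 1)"
  proof -
    have "isCont F 1" using F[of 1] by (auto intro: DERIV_isCont)
    then show ?thesis by (auto simp: isCont_def intro: tendsto_within_subset)
  qed
  have lim: "((F \<circ> real_of_ereal) \<longlongrightarrow> 0) (at_right 0)" "((F \<circ> real_of_ereal) \<longlongrightarrow> F 1) (at_left 1)"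
    unfolding zero_ereal_def one_ereal_def ereal_tendsto_simps using lim0 lim1 by simp_all
  have "AE x in lborel. 0 < ereal x \<longrightarrow> ereal x < 1 \<longrightarrow> 0 \<le> f x"
    by (rule AE_I2) (auto simp: f_def mult_nonneg_nonpos)
  moreover have "(F has_real_derivative f x) (at x)" "isCont f x" if "0 < ereal x" for x
    using that F by (auto simp: f_def[abs_def] intro!: continuous_intros)
  ultimately have "set_integrable lborel (einterval 0 1) f" "(LBINT x=0..1. f x) = F 1 - 0"
    using interval_integral_FTC_nonneg[OF _ _ _ _ lim] by simp_all
  then have "set_integrable lborel {0<..<1} f" "(LINT x:{0<..<1}|lborel. f x) = 1 / (real m + 1)\<^sup>2"
    by (simp_all add: E interval_lebesgue_integral_def F_def)
  then show ?thesis
    by (simp add: has_bochner_integral_iff set_integrable_def set_lebesgue_integral_def f_def)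
qed

text \<open>The alternating series is the full series minus twice its terms with even base. Those
  terms are a quarter of the full series, which leaves half of
  \<open>pi\<^sup>2 / 6\<close>.\<close>

lemma alternating_inverse_squares_sums:
  "(\<lambda>k. 1 / (real (2 * k) + 1)\<^sup>2 - 1 / (real (2 * k + 1) + 1)\<^sup>2) sums (pi\<^sup>2 / 12)"
proof -
  let ?a = "\<lambda>n. 1 / (real n + 1)\<^sup>2"
  have a: "?a sums (pi\<^sup>2 / 6)" using inverse_squares_sums by (simp add: add.commute)
  have "(\<lambda>k. \<Sum>n\<in>{k * 2..<k * 2 + 2}. ?a n) sums (pi\<^sup>2 / 6)"
    by (rule sums_group[OF a]) simp
  moreover have "(\<Sum>n\<in>{k * 2..<k * 2 + 2}. ?a n) = ?a (2 * k) + ?a (2 * k + 1)" for k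
    by (simp add: numeral_2_eq_2 mult.commute)
  moreover have "(\<lambda>k. 1 / 2 * ?a k) sums (1 / 2 * (pi\<^sup>2 / 6))" by (rule sums_mult[OF a])
  moreover have "2 * ?a (2 * k + 1) = 1 / 2 * ?a k" for k
  proof -
    have "real (2 * k + 1) + 1 = 2 * (real k + 1)" by simp
    then show ?thesis by (simp only: power_mult_distrib) simp
  qed
  ultimately have "(\<lambda>k. ?a (2 * k) + ?a (2 * k + 1) - 2 * ?a (2 * k + 1)) sums (pi\<^sup>2 / 6 - 1 / 2 * (pi\<^sup>2 / 6))"
    by (simp only: sums_diff)
  then show ?thesis by (simp add: algebra_simps)
qed

text \<open>The geometric series of \<open>1 / (1 + x)\<close> is integrated termwise. Consecutive
  terms are paired so that each \<open>g k\<close> is nonnegative and sum and integral may be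
  exchanged.\<close>

lemma nn_integral_ln_gauss:
  "(\<integral>\<^sup>+x. ennreal (indicator {0<..<1} x * (- ln x / (1 + x))) \<partial>lborel) = ennreal (pi\<^sup>2 / 12)"
proof -
  define g where "g k x = indicator {0<..<1} x * ((x ^ (2 * k) - x ^ (2 * k + 1)) * (- ln x))" for k :: nat and x :: real
  have g_nonneg: "g k x \<ge> 0" for k x
  proof (cases "x \<in> {0<..<1}")
    case True
    then have "x ^ (2 * k + 1) \<le> x ^ (2 * k)" by (intro power_decreasing) auto
    moreover have "ln x \<le> 0" using True by simp
    ultimately show ?thesis unfolding g_def by (intro mult_nonneg_nonneg) auto
  qed (simp add: g_def)
  have g_int: "has_bochner_integral lborel (g k) (1 / (real (2 * k) + 1)\<^sup>2 - 1 / (real (2 * k + 1) + 1)\<^sup>2)" for k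
  proof -
    have "g k = (\<lambda>x. indicator {0<..<1} x * (x ^ (2 * k) * (- ln x)) - indicator {0<..<1} x * (x ^ (2 * k + 1) * (- ln x)))"
      by (simp add: g_def fun_eq_iff algebra_simps)
    then show ?thesis
      using has_bochner_integral_diff[OF has_bochner_integral_power_ln[of "2 * k"] has_bochner_integral_power_ln[of "2 * k + 1"]]
      by simp
  qed
  have "ennreal (indicator {0<..<1} x * (- ln x / (1 + x))) = (\<Sum>k. ennreal (g k x))" for x
  proof (rule suminf_ennreal_eq[symmetric, OF g_nonneg])
    show "(\<lambda>k. g k x) sums (indicator {0<..<1} x * (- ln x / (1 + x)))"
    proof (cases "x \<in> {0<..<1}")
      case True
      then have "norm (x\<^sup>2) < 1" by (simp add: power_less_one_iff abs_square_less_1)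
      then have "(\<lambda>k. (1 - x) * (- ln x) * (x\<^sup>2) ^ k) sums ((1 - x) * (- ln x) * (1 / (1 - x\<^sup>2)))"
        by (intro sums_mult geometric_sums)
      also have "(\<lambda>k. (1 - x) * (- ln x) * (x\<^sup>2) ^ k) = (\<lambda>k. g k x)"
        using True by (simp add: g_def fun_eq_iff power_mult[symmetric] algebra_simps)
      also have "(1 - x) * (- ln x) * (1 / (1 - x\<^sup>2)) = - ln x / (1 + x)"
      proof -
        have "1 - x\<^sup>2 = (1 - x) * (1 + x)" by (simp add: power2_eq_square algebra_simps)
        then show ?thesis using True by (simp add: divide_simps)
      qed
      finally show ?thesis using True by simp
    qed (simp add: g_def)
  qed
  then have "(\<integral>\<^sup>+x. ennreal (indicator {0<..<1} x * (- ln x / (1 + x))) \<partial>lborel) = (\<integral>\<^sup>+x. (\<Sum>k. ennreal (g k x)) \<partial>lborel)"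
    by simp
  also have "\<dots> = (\<Sum>k. \<integral>\<^sup>+x. ennreal (g k x) \<partial>lborel)"
    by (rule nn_integral_suminf) (simp add: g_def)
  also have "\<dots> = (\<Sum>k. ennreal (1 / (real (2 * k) + 1)\<^sup>2 - 1 / (real (2 * k + 1) + 1)\<^sup>2))"
    using g_int g_nonneg by (intro suminf_cong) (auto simp: has_bochner_integral_iff nn_integral_eq_integral)
  also have "\<dots> = ennreal (pi\<^sup>2 / 12)"
  proof (rule suminf_ennreal_eq[OF _ alternating_inverse_squares_sums])
    fix k
    have "(\<integral>x. g k x \<partial>lborel) \<ge> 0" using g_nonneg by simp
    then show "0 \<le> 1 / (real (2 * k) + 1)\<^sup>2 - 1 / (real (2 * k + 1) + 1)\<^sup>2"
      using g_int by (simp add: has_bochner_integral_iff)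
  qed
  finally show ?thesis .
qed

lemma has_bochner_integral_ln_gauss:
  "has_bochner_integral gauss_measure ln (- (pi\<^sup>2 / (12 * ln 2)))"
proof -
  have "has_bochner_integral gauss_measure (\<lambda>x. - ln x) (pi\<^sup>2 / (12 * ln 2))"
  proof (rule has_bochner_integral_nn_integral)
    show "AE x in gauss_measure. 0 \<le> - ln x"
      unfolding AE_gauss_measure by auto
    have "(\<integral>\<^sup>+x. ennreal (- ln x) \<partial>gauss_measure) =
        (\<integral>\<^sup>+x. ennreal (indicator {0<..<1} x * (1 / (ln 2 * (1 + x)))) * ennreal (- ln x) \<partial>lborel)"
      unfolding gauss_measure_def unit_density_def by (subst nn_integral_density) auto
    also have "\<dots> = (\<integral>\<^sup>+x. ennreal (1 / ln 2) * ennreal (indicator {0<..<1} x * (- ln x / (1 + x))) \<partial>lborel)"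
    proof (rule nn_integral_cong)
      fix x :: real
      show "ennreal (indicator {0<..<1} x * (1 / (ln 2 * (1 + x)))) * ennreal (- ln x) =
          ennreal (1 / ln 2) * ennreal (indicator {0<..<1} x * (- ln x / (1 + x)))"
      proof (cases "x \<in> {0<..<1}")
        case True
        then have "0 \<le> - ln x" "0 \<le> 1 / (ln 2 * (1 + x))" by auto
        then show ?thesis using True by (simp add: ennreal_mult'[symmetric] mult.commute)
      qed simp
    qed
    also have "\<dots> = ennreal (1 / ln 2) * ennreal (pi\<^sup>2 / 12)"
      by (subst nn_integral_cmult) (auto simp only: nn_integral_ln_gauss, measurable)
    also have "\<dots> = ennreal (pi\<^sup>2 / (12 * ln 2))"
      by (subst ennreal_mult'[symmetric]) (auto simp: mult.commute)
    finally show "(\<integral>\<^sup>+x. ennreal (- ln x) \<partial>gauss_measure) = ennreal (pi\<^sup>2 / (12 * ln 2))" .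
  qed auto
  from has_bochner_integral_minus[OF this] show ?thesis by simp
qed

subsection \<open>The error of continued fraction convergents\<close>

text \<open>By \<open>cfrac_error_step\<close> the logarithm of the error gains
  \<open>ln x + ln c\<close> per step, while the two Birkhoff sums gain \<open>2 * ln x\<close>.
  Replacing \<open>ln c\<close> by \<open>ln x\<close> costs at most \<open>2 * (1 / 2) ^ n\<close>,
  and \<open>4 - 4 * (1 / 2) ^ n\<close> is the sum of these costs. That the error is nonzero is
  carried along so that the logarithm splits.\<close>

lemma ln_cfrac_error:
  assumes "x \<in> irrationals01"
  shows "x \<noteq> of_rat (cfrac_convergent n x) \<and>
    \<bar>ln \<bar>x - of_rat (cfrac_convergent n x)\<bar>
      - (birkhoff_sum gauss_map ln n x + birkhoff_sum gauss_map ln (Suc n) x)\<bar> \<le> 4 - 4 * (1 / 2) ^ n"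
  using assms
proof (induction n arbitrary: x)
  case 0
  then show ?case by (auto simp: cfrac_convergent_eq irrationals01_def birkhoff_sum_def)
next
  case (Suc n)
  let ?y = "gauss_map x"
  let ?c = "real_of_rat (cfrac_convergent (Suc n) x)" and ?d = "real_of_rat (cfrac_convergent n ?y)"
  have y: "?y \<in> irrationals01" by (rule gauss_map_irrationals01[OF Suc.prems])
  note IH = Suc.IH[OF y] and step = cfrac_error_step[OF Suc.prems, of n]
  have x: "0 < x" using Suc.prems by (simp add: irrationals01_def)
  have pos: "\<bar>?y - ?d\<bar> > 0" using IH by simp
  then have "\<bar>x - ?c\<bar> > 0" unfolding step(1) using x step(2) by (intro mult_pos_pos) auto
  then have ne: "x \<noteq> ?c" by simp
  have "ln \<bar>x - ?c\<bar> = ln x + ln ?c + ln \<bar>?y - ?d\<bar>"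
    unfolding step(1) using x step(2) pos by (simp add: ln_mult_pos)
  moreover have "\<bar>ln x - ln ?c\<bar> \<le> 2 * (1 / 2) ^ n"
    using step(5) cfrac_error_le[OF y, of n] by linarith
  moreover have "(1 / 2 :: real) ^ Suc n = (1 / 2) ^ n / 2" by simp
  ultimately have "\<bar>ln \<bar>x - ?c\<bar> - (birkhoff_sum gauss_map ln (Suc n) x + birkhoff_sum gauss_map ln (Suc (Suc n)) x)\<bar>
      \<le> 4 - 4 * (1 / 2) ^ Suc n"
    using IH[THEN conjunct2] unfolding birkhoff_sum_Suc[of _ _ "Suc n" x] birkhoff_sum_Suc[of _ _ n x] by linarith
  then show ?case using ne by blast
qed

lemma AE_ln_cfrac_error_tendsto:
  "AE x in lborel. x \<in> {0<..<1} \<longrightarrow> (\<forall>n. x \<noteq> of_rat (cfrac_convergent n x)) \<and>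
    (\<lambda>n. ln \<bar>x - of_rat (cfrac_convergent n x)\<bar> / real n) \<longlonglongrightarrow> 2 * integral\<^sup>L gauss_measure ln"
  if int: "integrable gauss_measure ln"
proof -
  let ?S = "birkhoff_sum gauss_map ln" and ?I = "integral\<^sup>L gauss_measure ln"
  have "AE x in gauss_measure. (\<lambda>n. ?S n x / real n) \<longlonglongrightarrow> ?I"
    by (rule gauss.birkhoff_ergodic[OF int])
  then have "AE x in lborel. x \<in> {0<..<1} \<longrightarrow> (\<lambda>n. ?S n x / real n) \<longlonglongrightarrow> ?I"
    by (simp only: AE_gauss_measure)
  moreover have "(\<rat> :: real set) \<in> null_sets lborel" by (intro countable_imp_null_set_lborel countable_rat)
  then have "AE x in lborel. x \<notin> (\<rat> :: real set)" by (rule AE_not_in)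
  ultimately show ?thesis
  proof eventually_elim
    case (elim x)
    show ?case
    proof
      assume "x \<in> {0<..<1}"
      then have x: "x \<in> irrationals01" and S: "(\<lambda>n. ?S n x / real n) \<longlonglongrightarrow> ?I"
        using elim by (auto simp: irrationals01_def)
      let ?E = "\<lambda>n. ln \<bar>x - of_rat (cfrac_convergent n x)\<bar>"
      have "(\<lambda>n. ?S (Suc n) x / real (Suc n)) \<longlonglongrightarrow> ?I" by (rule LIMSEQ_Suc[OF S])
      \<comment> \<open>Corrects the normalization of the longer sum from \<open>Suc n\<close> to
        \<open>n\<close>.\<close>
      moreover have "(\<lambda>n. real (Suc n) / real n) \<longlonglongrightarrow> 1" by real_asymp
      ultimately have "(\<lambda>n. ?S (Suc n) x / real (Suc n) * (real (Suc n) / real n)) \<longlonglongrightarrow> ?I * 1"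
        by (rule tendsto_mult)
      then have S': "(\<lambda>n. ?S (Suc n) x / real n) \<longlonglongrightarrow> ?I" by simp
      have "(\<lambda>n. (?E n - (?S n x + ?S (Suc n) x)) / real n) \<longlonglongrightarrow> 0"
      proof (rule tendsto_0_le[where K=1])
        show "(\<lambda>n. 4 / real n) \<longlonglongrightarrow> 0" by (rule lim_const_over_n)
        show "\<forall>\<^sub>F n in sequentially. norm ((?E n - (?S n x + ?S (Suc n) x)) / real n) \<le> norm (4 / real n) * 1"
        proof (rule always_eventually, rule allI)
          fix n
          have "\<bar>?E n - (?S n x + ?S (Suc n) x)\<bar> \<le> 4"
            using ln_cfrac_error[OF x, of n] zero_le_power[of "1 / 2 :: real" n] by linarith
          then show "norm ((?E n - (?S n x + ?S (Suc n) x)) / real n) \<le> norm (4 / real n) * 1"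
            by (simp add: divide_right_mono)
        qed
      qed
      from tendsto_add[OF this tendsto_add[OF S S']]
      have "(\<lambda>n. ?E n / real n) \<longlonglongrightarrow> 2 * ?I"
        by (simp add: add_divide_distrib diff_divide_distrib)
      moreover have "\<forall>n. x \<noteq> of_rat (cfrac_convergent n x)" using ln_cfrac_error[OF x] by blast
      ultimately show "(\<forall>n. x \<noteq> of_rat (cfrac_convergent n x)) \<and> (\<lambda>n. ?E n / real n) \<longlonglongrightarrow> 2 * ?I" by blast
    qed
  qed
qed

subsection \<open>The error of beta-expansions\<close>

text \<open>The digit with index \<open>Suc n\<close> is the integer part of \<open>\<beta>\<close>
  times the iterate of order \<open>n\<close>; subtracting it leaves the next iterate.\<close>

lemma beta_convergent_error: "x - beta_convergent \<beta> n x = (beta_map \<beta> ^^ n) x / \<beta> ^ n" if "\<beta> > 1"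
proof (induction n)
  case (Suc n)
  have "x - beta_convergent \<beta> (Suc n) x = (x - beta_convergent \<beta> n x) - of_int \<lfloor>\<beta> * (beta_map \<beta> ^^ n) x\<rfloor> / \<beta> ^ Suc n"
    by (simp add: beta_convergent_def beta_digit_def)
  also have "\<dots> = (beta_map \<beta> ^^ Suc n) x / \<beta> ^ Suc n"
    unfolding Suc using that by (simp add: beta_map_def[of \<beta> "(beta_map \<beta> ^^ n) x"] diff_divide_distrib)
  finally show ?case .
qed (simp add: beta_convergent_def)

lemma beta_map_bounds: "0 \<le> beta_map \<beta> x" "beta_map \<beta> x < 1"
  unfolding beta_map_def by linarith+

lemma funpow_beta_map_less_1: "x < 1 \<Longrightarrow> (beta_map \<beta> ^^ n) x < 1"
  by (cases n) (auto simp: beta_map_bounds)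

lemma funpow_beta_map_measurable [measurable]: "(beta_map \<beta> ^^ n) \<in> borel_measurable borel"
proof (rule measurable_compose_n)
  show "beta_map \<beta> \<in> borel_measurable borel" unfolding beta_map_def[abs_def] by measurable
qed

lemma emeasure_lborel_affine_vimage_le:
  fixes c :: real
  assumes c: "c > 0" and S [measurable]: "S \<in> sets borel" and le: "emeasure lborel S \<le> ennreal z"
  shows "emeasure lborel ((\<lambda>x. c * x - t) -` S) \<le> ennreal (z / c)"
proof -
  let ?P = "(\<lambda>x. c * x - t) -` S"
  have "emeasure lborel S = emeasure (density (distr lborel borel (\<lambda>x. - t + c * x)) (\<lambda>_. ennreal \<bar>c\<bar>)) S"
    using lborel_real_affine[of c "- t"] c by simp
  also have "\<dots> = ennreal c * emeasure lborel ?P"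
    using c by (subst emeasure_density_const) (auto simp: emeasure_distr)
  finally have *: "ennreal c * emeasure lborel ?P \<le> ennreal z" using le by simp
  have "emeasure lborel ?P = ennreal (1 / c) * (ennreal c * emeasure lborel ?P)"
    using c by (simp add: mult.assoc[symmetric] ennreal_mult'[symmetric])
  also have "\<dots> \<le> ennreal (1 / c) * ennreal z" by (intro mult_left_mono *) simp
  also have "\<dots> = ennreal (z / c)" using c by (simp add: ennreal_mult'[symmetric])
  finally show ?thesis .
qed

text \<open>The initial interval \<open>[0, r)\<close> splits into \<open>\<lfloor>\<beta> r\<rfloor>\<close> intervals on which \<open>T\<^sub>\<beta>\<close> maps onto \<open>[0, 1)\<close> and one that it
  maps onto \<open>[0, r')\<close>, where \<open>r'\<close> is the fractional part of \<open>\<beta> r\<close>.\<close>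

lemma emeasure_beta_map_small:
  assumes \<beta>: "\<beta> > 1" and \<delta>: "0 \<le> \<delta>" and r: "0 \<le> r" "r \<le> 1"
  shows "emeasure lborel {x\<in>{0..<r}. (beta_map \<beta> ^^ n) x < \<delta>}
    \<le> ennreal (\<delta> * (r * (\<Sum>i<n. (1 / \<beta>) ^ i) + (1 / \<beta>) ^ n))"
  using r
proof (induction n arbitrary: r)
  case 0
  have "emeasure lborel {x\<in>{0..<r}. (beta_map \<beta> ^^ 0) x < \<delta>} \<le> emeasure lborel {0..<\<delta>}"
    by (intro emeasure_mono) auto
  then show ?case using \<delta> by simp
next
  case (Suc n)
  define S where "S r = {x\<in>{0..<r}. (beta_map \<beta> ^^ n) x < \<delta>}" for r
  have S [measurable]: "S r \<in> sets borel" for r unfolding S_def by measurable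
  \<comment> \<open>There are \<open>m\<close> full branches; the incomplete one leads to the
    interval of length \<open>r'\<close>, which is why the induction generalizes over
    \<open>r\<close>.\<close>
  define m where "m = nat \<lfloor>\<beta> * r\<rfloor>"
  define r' where "r' = \<beta> * r - real m"
  define a where "a = (\<Sum>i<n. (1 / \<beta>) ^ i)"
  define e where "e = (1 / \<beta>) ^ n"
  have m: "real m = of_int \<lfloor>\<beta> * r\<rfloor>" using \<beta> Suc.prems by (simp add: m_def)
  have r': "0 \<le> r'" "r' \<le> 1" unfolding r'_def m by linarith+
  have ae: "a \<ge> 0" "e \<ge> 0" using \<beta> by (auto simp: a_def e_def intro!: sum_nonneg)
  let ?P = "\<lambda>k r. (\<lambda>x. \<beta> * x - real k) -` S r"
  have P_sets [measurable]: "?P k r \<in> sets borel" for k r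
    using measurable_sets[of "\<lambda>x. \<beta> * x - real k" borel borel "S r"] S by simp
  have P_le: "emeasure lborel (?P k r) \<le> ennreal (\<delta> * (r * a + e) / \<beta>)" if "0 \<le> r" "r \<le> 1" for k r
    using Suc.IH[OF that] \<beta> by (intro emeasure_lborel_affine_vimage_le) (auto simp: S_def a_def e_def)
  have "{x\<in>{0..<r}. (beta_map \<beta> ^^ Suc n) x < \<delta>} \<subseteq> (\<Union>k<m. ?P k 1) \<union> ?P m r'"
  proof
    fix x assume x: "x \<in> {x\<in>{0..<r}. (beta_map \<beta> ^^ Suc n) x < \<delta>}"
    define k where "k = nat \<lfloor>\<beta> * x\<rfloor>"
    have "0 \<le> \<beta> * x" using x \<beta> by simp
    then have k: "real k = of_int \<lfloor>\<beta> * x\<rfloor>" by (simp add: k_def)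
    then have T: "beta_map \<beta> x = \<beta> * x - real k" by (simp add: beta_map_def)
    have "\<beta> * x < \<beta> * r" using x \<beta> by simp
    then have "k \<le> m" unfolding k_def m_def by (intro nat_mono floor_mono) simp
    moreover have "(beta_map \<beta> ^^ n) (\<beta> * x - real k) < \<delta>" using x by (simp add: T[symmetric] funpow_swap1)
    moreover have "0 \<le> \<beta> * x - real k" "\<beta> * x - real k < 1" using beta_map_bounds[of \<beta> x] by (simp_all add: T)
    moreover have "\<beta> * x - real m < r'" using \<open>\<beta> * x < \<beta> * r\<close> by (simp add: r'_def)
    ultimately show "x \<in> (\<Union>k<m. ?P k 1) \<union> ?P m r'"
      by (cases "k = m") (auto simp: S_def)
  qed
  then have "emeasure lborel {x\<in>{0..<r}. (beta_map \<beta> ^^ Suc n) x < \<delta>} \<le> emeasure lborel ((\<Union>k<m. ?P k 1) \<union> ?P m r')"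
    by (intro emeasure_mono) auto
  also have "\<dots> \<le> emeasure lborel (\<Union>k<m. ?P k 1) + emeasure lborel (?P m r')"
    by (rule emeasure_subadditive) auto
  also have "\<dots> \<le> (\<Sum>k<m. emeasure lborel (?P k 1)) + emeasure lborel (?P m r')"
    by (intro add_right_mono emeasure_subadditive_finite) auto
  also have "\<dots> \<le> (\<Sum>k<m. ennreal (\<delta> * (1 * a + e) / \<beta>)) + ennreal (\<delta> * (r' * a + e) / \<beta>)"
    using r' by (intro add_mono sum_mono P_le) auto
  also have "\<dots> = ennreal (real m * (\<delta> * (1 * a + e) / \<beta>) + \<delta> * (r' * a + e) / \<beta>)"
  proof -
    have "(\<Sum>k<m. ennreal z) + ennreal w = ennreal (real m * z + w)" if "z \<ge> 0" "w \<ge> 0" for z w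
      using that by (simp add: ennreal_mult ennreal_of_nat_eq_real_of_nat)
    then show ?thesis using \<delta> ae \<beta> r' by simp
  qed
  also have "\<dots> \<le> ennreal (\<delta> * (r * (a + e) + e / \<beta>))"
  proof (rule ennreal_leI)
    \<comment> \<open>As \<open>m + r' = \<beta> * r\<close>, the terms in \<open>a\<close> add up
      exactly, and only the incomplete branch contributes an additional \<open>e\<close>.\<close>
    have "real m \<le> \<beta> * r" using r' by (simp add: r'_def)
    then have "real m * e \<le> \<beta> * r * e" using ae by (intro mult_right_mono)
    moreover have "real m * (a + e) + (r' * a + e) = \<beta> * r * a + real m * e + e"
      by (simp add: r'_def algebra_simps)
    ultimately have "real m * (a + e) + (r' * a + e) \<le> \<beta> * r * (a + e) + e" by (simp add: algebra_simps)
    then have "\<delta> / \<beta> * (real m * (a + e) + (r' * a + e)) \<le> \<delta> / \<beta> * (\<beta> * r * (a + e) + e)"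
      using \<delta> \<beta> by (intro mult_left_mono) auto
    also have "\<delta> / \<beta> * (real m * (a + e) + (r' * a + e)) = real m * (\<delta> * (1 * a + e) / \<beta>) + \<delta> * (r' * a + e) / \<beta>"
      by (simp add: add_divide_distrib algebra_simps)
    also have "\<delta> / \<beta> * (\<beta> * r * (a + e) + e) = \<delta> * (r * (a + e) + e / \<beta>)"
      using \<beta> by (simp add: field_simps)
    finally show "real m * (\<delta> * (1 * a + e) / \<beta>) + \<delta> * (r' * a + e) / \<beta> \<le> \<delta> * (r * (a + e) + e / \<beta>)" .
  qed
  finally show ?case by (simp add: a_def e_def)
qed

text \<open>With \<open>\<delta> = exp (- \<eta> * n)\<close> and \<open>r = 1\<close> the preceding
  bound is a summable geometric sequence, so Borel-Cantelli applies.\<close>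

lemma AE_beta_map_lower_bound:
  assumes \<beta>: "\<beta> > 1" and \<eta>: "\<eta> > 0"
  shows "AE x in lborel. x \<in> {0..<1} \<longrightarrow> eventually (\<lambda>n. (beta_map \<beta> ^^ n) x \<ge> exp (- \<eta> * real n)) sequentially"
proof -
  define A where "A n = {x\<in>{0..<1}. (beta_map \<beta> ^^ n) x < exp (- \<eta> * real n)}" for n
  \<comment> \<open>The full geometric series plus 1 for the isolated last power.\<close>
  define C where "C = 1 / (1 - 1 / \<beta>) + 1"
  have A [measurable]: "A n \<in> sets borel" for n unfolding A_def by measurable
  have A_le: "emeasure lborel (A n) \<le> ennreal (C * exp (- \<eta>) ^ n)" for n
  proof -
    have "emeasure lborel (A n) \<le> ennreal (exp (- \<eta> * real n) * (1 * (\<Sum>i<n. (1 / \<beta>) ^ i) + (1 / \<beta>) ^ n))"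
      unfolding A_def using \<beta> by (intro emeasure_beta_map_small) auto
    also have "\<dots> \<le> ennreal (exp (- \<eta> * real n) * C)"
    proof (intro ennreal_leI mult_left_mono)
      have "(\<Sum>i<n. (1 / \<beta>) ^ i) \<le> (\<Sum>i. (1 / \<beta>) ^ i)"
        using \<beta> by (intro sum_le_suminf summable_geometric) auto
      also have "\<dots> = 1 / (1 - 1 / \<beta>)" using \<beta> by (intro suminf_geometric) auto
      finally show "1 * (\<Sum>i<n. (1 / \<beta>) ^ i) + (1 / \<beta>) ^ n \<le> C"
        using \<beta> power_le_one[of "1 / \<beta>" n] by (simp add: C_def)
    qed simp
    also have "exp (- \<eta> * real n) * C = C * exp (- \<eta>) ^ n"
      by (simp add: exp_of_nat2_mult[symmetric] mult.commute)
    finally show ?thesis .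
  qed
  have C: "C \<ge> 0" using \<beta> by (simp add: C_def)
  have "AE x in lborel. eventually (\<lambda>n. x \<in> space lborel - A n) sequentially"
  proof (rule borel_cantelli_AE1)
    show "emeasure lborel (A n) < \<infinity>" for n using A_le[of n] by (rule le_less_trans) simp
    show "summable (\<lambda>n. measure lborel (A n))"
    proof (rule summable_comparison_test')
      show "summable (\<lambda>n. C * exp (- \<eta>) ^ n)" using \<eta> by (intro summable_mult summable_geometric) simp
      show "norm (measure lborel (A n)) \<le> C * exp (- \<eta>) ^ n" for n
        using A_le[of n] C by (simp add: measure_def enn2real_leI)
    qed
  qed (simp add: A)
  then show ?thesis by eventually_elim (auto simp: A_def not_less elim!: eventually_mono)
qed

subsection \<open>Comparison of the two expansions\<close>

lemma AE_lebesgue_on_unitI: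
  "AE x in lborel. x \<in> {0<..<1} \<longrightarrow> P x \<Longrightarrow> AE x in lebesgue_on {0..<1::real}. P x"
proof -
  assume "AE x in lborel. x \<in> {0<..<1} \<longrightarrow> P x"
  moreover have "AE x in lborel. x \<noteq> (0::real)" by (rule AE_lborel_singleton)
  ultimately have "AE x in lborel. x \<in> {0..<1} \<longrightarrow> P x" by eventually_elim auto
  then show ?thesis by (subst AE_restrict_space_iff) (auto intro: AE_completion)
qed

lemma AE_ln_cfrac_error_Levy:
  "AE x in lborel. x \<in> {0<..<1} \<longrightarrow> (\<forall>n. x \<noteq> of_rat (cfrac_convergent n x)) \<and>
    (\<lambda>n. ln \<bar>x - of_rat (cfrac_convergent n x)\<bar> / real n) \<longlonglongrightarrow> - (pi\<^sup>2 / (6 * ln 2))"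
  using AE_ln_cfrac_error_tendsto has_bochner_integral_ln_gauss
  by (simp add: has_bochner_integral_iff)

lemma eventually_sequentially_pos:
  "eventually P sequentially \<longleftrightarrow> (\<exists>N>0. \<forall>n\<ge>N. P n)"
  unfolding eventually_sequentially
  by (metis dual_order.trans le_add2 zero_less_Suc Suc_eq_plus1_left le_add1 plus_1_eq_Suc)

theorem corollary1p4:
  fixes \<beta> :: real
  assumes "\<beta> > 1"
  shows "(ln \<beta> > pi\<^sup>2 / (6 * ln 2) \<longrightarrow>
      (AE x in lebesgue_on {0..<1}. \<exists>N\<^sub>1>0. \<forall>n\<ge>N\<^sub>1.
        \<bar>x - real_of_int (cfrac_num n x) / real_of_int (cfrac_denom n x)\<bar>
          > x - beta_convergent \<beta> n x)) \<and>
    (ln \<beta> < pi\<^sup>2 / (6 * ln 2) \<longrightarrow>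
      (AE x in lebesgue_on {0..<1}. \<exists>N\<^sub>2>0. \<forall>n\<ge>N\<^sub>2.
        \<bar>x - real_of_int (cfrac_num n x) / real_of_int (cfrac_denom n x)\<bar>
          < x - beta_convergent \<beta> n x))"
proof (intro conjI impI)
  let ?L = "pi\<^sup>2 / (6 * ln 2)"
  let ?E = "\<lambda>n x. \<bar>x - real_of_rat (cfrac_convergent n x)\<bar>"
  have pow: "1 / \<beta> ^ n = exp (- ln \<beta> * real n)" for n
    using assms by (simp add: exp_of_nat2_mult exp_minus power_one_over inverse_eq_divide del: mult_minus_left)
  {
    assume less: "ln \<beta> > ?L"
    show "AE x in lebesgue_on {0..<1}. \<exists>N\<^sub>1>0. \<forall>n\<ge>N\<^sub>1.
        \<bar>x - real_of_int (cfrac_num n x) / real_of_int (cfrac_denom n x)\<bar> > x - beta_convergent \<beta> n x"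
      unfolding eventually_sequentially_pos[symmetric] cfrac_num_div_denom
    proof (rule AE_lebesgue_on_unitI)
      show "AE x in lborel. x \<in> {0<..<1} \<longrightarrow> eventually (\<lambda>n. ?E n x > x - beta_convergent \<beta> n x) sequentially"
        using AE_ln_cfrac_error_Levy
      proof (rule AE_mp, intro AE_I2 impI)
        fix x :: real assume x: "x \<in> {0<..<1}" and
          lim: "x \<in> {0<..<1} \<longrightarrow> (\<forall>n. x \<noteq> of_rat (cfrac_convergent n x)) \<and> (\<lambda>n. ln (?E n x) / real n) \<longlonglongrightarrow> - ?L"
        \<comment> \<open>In this case \<open>- ln \<beta>\<close> lies strictly below the limit,
          and the beta error is at most \<open>1 / \<beta> ^ n\<close>.\<close>
        have "eventually (\<lambda>n. - ln \<beta> < ln (?E n x) / real n) sequentially"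
          using lim x less by (intro order_tendstoD(1)) auto
        then show "eventually (\<lambda>n. ?E n x > x - beta_convergent \<beta> n x) sequentially"
          using eventually_gt_at_top[of 0]
        proof eventually_elim
          case (elim n)
          have "x - beta_convergent \<beta> n x = (beta_map \<beta> ^^ n) x / \<beta> ^ n"
            by (rule beta_convergent_error[OF assms])
          also have "\<dots> \<le> 1 / \<beta> ^ n"
            using funpow_beta_map_less_1[where x=x and \<beta>=\<beta> and n=n] x assms by (intro divide_right_mono) auto
          also have "\<dots> = exp (- ln \<beta> * real n)" by (rule pow)
          also have "\<dots> < ?E n x"
          proof -
            have *: "- ln \<beta> * real n < ln (?E n x)" using elim by (simp add: pos_less_divide_eq)
            have "?E n x > 0" using lim x by simp
            then show ?thesis using * by (metis exp_less_mono exp_ln)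
          qed
          finally show ?case .
        qed
      qed
    qed
  }
  {
    assume less: "ln \<beta> < ?L"
    \<comment> \<open>Half the gap between the rates: the beta error may lose a factor
      \<open>exp (- \<eta> * n)\<close> and still decay strictly more slowly than the continued
      fraction error.\<close>
    define \<eta> where "\<eta> = (?L - ln \<beta>) / 2"
    have \<eta>: "\<eta> > 0" "- ?L < - ln \<beta> - \<eta>" using less by (auto simp: \<eta>_def field_simps)
    show "AE x in lebesgue_on {0..<1}. \<exists>N\<^sub>2>0. \<forall>n\<ge>N\<^sub>2.
        \<bar>x - real_of_int (cfrac_num n x) / real_of_int (cfrac_denom n x)\<bar> < x - beta_convergent \<beta> n x"
      unfolding eventually_sequentially_pos[symmetric] cfrac_num_div_denom
    proof (rule AE_lebesgue_on_unitI)
      show "AE x in lborel. x \<in> {0<..<1} \<longrightarrow> eventually (\<lambda>n. ?E n x < x - beta_convergent \<beta> n x) sequentially"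
        using AE_conjI[OF AE_ln_cfrac_error_Levy AE_beta_map_lower_bound[OF assms \<eta>(1)]]
      proof (rule AE_mp, intro AE_I2 impI, elim conjE)
        fix x :: real assume x: "x \<in> {0<..<1}" and
          lim: "x \<in> {0<..<1} \<longrightarrow> (\<forall>n. x \<noteq> of_rat (cfrac_convergent n x)) \<and> (\<lambda>n. ln (?E n x) / real n) \<longlonglongrightarrow> - ?L" and
          low: "x \<in> {0..<1} \<longrightarrow> eventually (\<lambda>n. (beta_map \<beta> ^^ n) x \<ge> exp (- \<eta> * real n)) sequentially"
        have "eventually (\<lambda>n. ln (?E n x) / real n < - ln \<beta> - \<eta>) sequentially"
          using lim x \<eta>(2) by (intro order_tendstoD(2)) auto
        moreover have "eventually (\<lambda>n. (beta_map \<beta> ^^ n) x \<ge> exp (- \<eta> * real n)) sequentially"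
          using low x by simp
        ultimately show "eventually (\<lambda>n. ?E n x < x - beta_convergent \<beta> n x) sequentially"
          using eventually_gt_at_top[of 0]
        proof eventually_elim
          case (elim n)
          have *: "ln (?E n x) < (- ln \<beta> - \<eta>) * real n" using elim by (simp add: pos_divide_less_eq)
          have "?E n x < exp ((- ln \<beta> - \<eta>) * real n)"
          proof (cases "?E n x = 0")
            case False
            then have "?E n x > 0" by linarith
            then show ?thesis using * by (metis exp_less_mono exp_ln)
          qed simp
          also have "\<dots> = exp (- \<eta> * real n) * (1 / \<beta> ^ n)"
            unfolding pow by (simp add: exp_add[symmetric] algebra_simps)
          also have "\<dots> \<le> (beta_map \<beta> ^^ n) x * (1 / \<beta> ^ n)"
            using elim assms by (intro mult_right_mono) auto
          also have "\<dots> = x - beta_convergent \<beta> n x"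
            unfolding beta_convergent_error[OF assms] by simp
          finally show ?case .
        qed
      qed
    qed
  }
qed

end
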